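(* Let $D$ be a skew field, $\sigma$ a ring automorphism of $D$, $\delta$ a $\sigma$-derivation of $D$, and let $R=D[X;\sigma,\delta]$ be free of finite rank $r$ over its center $C$. Let $f\in R$ be such that $f^*\in C$. If $f^*$ is a prime twosided polynomial and $\deg f^*=\sqrt{r}\,\deg f$, then $f$ is irreducible and the endomorphism ring $\operatorname{End}({}_R R/Rf)$ of the left $R$-module $R/Rf$ is commutative.
   Context: A $\sigma$-derivation is an additive map $\delta:D\to D$ with $\delta(ab)=\sigma(a)\delta(b)+\delta(a)b$. $R=D[X;\sigma,\delta]$ is the Ore polynomial ring: a left $D$-vector space with basis $\{X^n: n\ge 0\}$, with $Xa=\sigma(a)X+\delta(a)$ for $a\in D$. A polynomial $\alpha$ is twosided if $R\alpha=\alpha R$. A twosided polynomial $\pi$ of positive degree is prime twosided if $R\pi$ is maximal as a twosided ideal (equivalently, $R/R\pi$ is a simple Artinian ring). A bound of $f\in R$ is a twosided polynomial $f^*$ such that $Rf^*=f^*R$ is the largest twosided ideal contained in $Rf$; equivalently $Rf^*=\operatorname{Ann}_R(R/Rf)$. It is determined up to left multiplication by nonzero elements of $D$. *)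

theory Defs
  imports "HOL-Algebra.Algebra" "HOL-Computational_Algebra.Polynomial"
begin

section \<open>Ore polynomial rings\<close>

definition ring_automorphism :: "('a::division_ring \<Rightarrow> 'a) \<Rightarrow> bool" where
  "ring_automorphism \<sigma> \<longleftrightarrow> bij \<sigma> \<and> \<sigma> 1 = 1 \<and>
     (\<forall>a b. \<sigma> (a + b) = \<sigma> a + \<sigma> b) \<and> (\<forall>a b. \<sigma> (a * b) = \<sigma> a * \<sigma> b)"

definition sigma_derivation ::
    "('a::division_ring \<Rightarrow> 'a) \<Rightarrow> ('a \<Rightarrow> 'a) \<Rightarrow> bool" where
  "sigma_derivation \<sigma> \<delta> \<longleftrightarrow>
     (\<forall>a b. \<delta> (a + b) = \<delta> a + \<delta> b) \<and> (\<forall>a b. \<delta> (a * b) = \<sigma> a * \<delta> b + \<delta> a * b)"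

text \<open>
  The type \<^typ>\<open>'a poly\<close> is used only for its additive group, coefficients and degree:
  \<open>p\<close> stands for \<open>\<Sum>i. coeff p i X\<^sup>i\<close> with coefficients on the left. The product of the library
  is unavailable, since \<^typ>\<open>'a\<close> need not be commutative. Left multiplication by
  \<open>X\<close> is forced by \<open>X a = \<sigma> a X + \<delta> a\<close>.
\<close>

definition ore_scale :: "'a::division_ring \<Rightarrow> 'a poly \<Rightarrow> 'a poly" where
  "ore_scale a p = map_poly (\<lambda>b. a * b) p"

definition ore_X_mult ::
    "('a::division_ring \<Rightarrow> 'a) \<Rightarrow> ('a \<Rightarrow> 'a) \<Rightarrow> 'a poly \<Rightarrow> 'a poly" where
  "ore_X_mult \<sigma> \<delta> p = pCons 0 (map_poly \<sigma> p) + map_poly \<delta> p"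

definition ore_mult ::
    "('a::division_ring \<Rightarrow> 'a) \<Rightarrow> ('a \<Rightarrow> 'a) \<Rightarrow> 'a poly \<Rightarrow> 'a poly \<Rightarrow> 'a poly" where
  "ore_mult \<sigma> \<delta> p q =
     (\<Sum>i\<le>degree p. ore_scale (coeff p i) ((ore_X_mult \<sigma> \<delta> ^^ i) q))"

definition ore_ring ::
    "('a::division_ring \<Rightarrow> 'a) \<Rightarrow> ('a \<Rightarrow> 'a) \<Rightarrow> 'a poly ring" where
  "ore_ring \<sigma> \<delta> =
     \<lparr>carrier = UNIV, monoid.mult = ore_mult \<sigma> \<delta>, monoid.one = [:1:],
      ring.zero = 0, ring.add = (+)\<rparr>"

lemma coeff_ore_scale [simp]: "coeff (ore_scale a p) n = a * coeff p n"
  by (simp add: ore_scale_def coeff_map_poly)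

lemma ore_scale_0 [simp]: "ore_scale 0 p = 0"
  and ore_scale_0_right [simp]: "ore_scale a 0 = 0"
  and ore_scale_1 [simp]: "ore_scale 1 p = p"
  and ore_scale_add_left: "ore_scale (a + b) p = ore_scale a p + ore_scale b p"
  and ore_scale_add_right: "ore_scale a (p + q) = ore_scale a p + ore_scale a q"
  and ore_scale_scale: "ore_scale a (ore_scale b p) = ore_scale (a * b) p"
  by (auto intro!: poly_eqI simp: algebra_simps)

lemma ore_scale_sum: "ore_scale a (\<Sum>i\<in>A. f i) = (\<Sum>i\<in>A. ore_scale a (f i))"
  by (induction A rule: infinite_finite_induct) (simp_all add: ore_scale_add_right)

locale ore_data =
  fixes \<sigma> \<delta> :: "'a::division_ring \<Rightarrow> 'a"
  assumes automorphism: "ring_automorphism \<sigma>"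
    and derivation: "sigma_derivation \<sigma> \<delta>"
begin

abbreviation T where "T \<equiv> ore_X_mult \<sigma> \<delta>"

lemma sigma_add: "\<sigma> (a + b) = \<sigma> a + \<sigma> b" and sigma_mult: "\<sigma> (a * b) = \<sigma> a * \<sigma> b"
  and sigma_1 [simp]: "\<sigma> 1 = 1"
  using automorphism by (auto simp: ring_automorphism_def)

lemma delta_add: "\<delta> (a + b) = \<delta> a + \<delta> b" and delta_mult: "\<delta> (a * b) = \<sigma> a * \<delta> b + \<delta> a * b"
  using derivation by (auto simp: sigma_derivation_def)

lemma sigma_0 [simp]: "\<sigma> 0 = 0"
  using sigma_add[of 0 0] by simp

lemma delta_0 [simp]: "\<delta> 0 = 0"
  using delta_add[of 0 0] by simp

lemma delta_1 [simp]: "\<delta> 1 = 0"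
  using delta_mult[of 1 1] by simp

lemma coeff_T: "coeff (T p) n = (case n of 0 \<Rightarrow> 0 | Suc m \<Rightarrow> \<sigma> (coeff p m)) + \<delta> (coeff p n)"
  by (simp add: ore_X_mult_def coeff_pCons coeff_map_poly split: nat.splits)

lemma T_add: "T (p + q) = T p + T q"
  by (rule poly_eqI) (simp add: coeff_T sigma_add delta_add algebra_simps split: nat.splits)

lemma T_0 [simp]: "T 0 = 0"
  by (rule poly_eqI) (simp add: coeff_T split: nat.splits)

lemma T_sum: "T (\<Sum>i\<in>A. f i) = (\<Sum>i\<in>A. T (f i))"
  by (induction A rule: infinite_finite_induct) (simp_all add: T_add)

lemma T_scale: "T (ore_scale a p) = ore_scale (\<sigma> a) (T p) + ore_scale (\<delta> a) p"
  by (rule poly_eqI)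
    (simp add: coeff_T sigma_mult delta_mult algebra_simps split: nat.splits)

lemma Tn_add: "(T ^^ i) (p + q) = (T ^^ i) p + (T ^^ i) q"
  by (induction i) (simp_all add: T_add)

lemma Tn_one: "(T ^^ i) [:1:] = monom 1 i"
proof (induction i)
  case (Suc i)
  have "T (monom 1 i) = monom 1 (Suc i)"
    by (rule poly_eqI) (auto simp: coeff_T split: nat.splits)
  with Suc show ?case by simp
qed (simp add: monom_0)

lemma mult_eq_sum:
  assumes "degree p \<le> n"
  shows "ore_mult \<sigma> \<delta> p q = (\<Sum>i\<le>n. ore_scale (coeff p i) ((T ^^ i) q))"
  unfolding ore_mult_def
  by (rule sum.mono_neutral_left) (use assms in \<open>auto simp: coeff_eq_0\<close>)

lemma mult_add_left: "ore_mult \<sigma> \<delta> (p + p') q = ore_mult \<sigma> \<delta> p q + ore_mult \<sigma> \<delta> p' q"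
proof -
  define n where "n = max (degree p) (degree p')"
  have "degree (p + p') \<le> n" by (simp add: n_def degree_add_le_max)
  then show ?thesis
    by (simp add: mult_eq_sum[of _ n] n_def ore_scale_add_left sum.distrib)
qed

lemma mult_add_right: "ore_mult \<sigma> \<delta> p (q + q') = ore_mult \<sigma> \<delta> p q + ore_mult \<sigma> \<delta> p q'"
  by (simp add: ore_mult_def Tn_add ore_scale_add_right sum.distrib)

lemma mult_0_left [simp]: "ore_mult \<sigma> \<delta> 0 q = 0"
  by (simp add: ore_mult_def)

lemma mult_sum_left: "ore_mult \<sigma> \<delta> (\<Sum>i\<in>A. f i) q = (\<Sum>i\<in>A. ore_mult \<sigma> \<delta> (f i) q)"
  by (induction A rule: infinite_finite_induct) (simp_all add: mult_add_left)

lemma mult_one_left: "ore_mult \<sigma> \<delta> [:1:] q = q"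
  by (simp add: ore_mult_def)

lemma mult_one_right: "ore_mult \<sigma> \<delta> p [:1:] = p"
  by (rule poly_eqI) (auto simp: ore_mult_def Tn_one coeff_sum coeff_eq_0 if_distrib cong: if_cong)

lemma mult_scale_left: "ore_mult \<sigma> \<delta> (ore_scale a p) q = ore_scale a (ore_mult \<sigma> \<delta> p q)"
proof -
  have "degree (ore_scale a p) \<le> degree p"
    by (rule degree_le) (simp add: coeff_eq_0)
  then show ?thesis
    by (simp add: mult_eq_sum[of _ "degree p"] ore_scale_sum ore_scale_scale)
qed

lemma mult_T_left: "ore_mult \<sigma> \<delta> (T p) q = T (ore_mult \<sigma> \<delta> p q)"
proof -
  let ?n = "degree p"
  have "degree (T p) \<le> Suc ?n"
    by (rule degree_le) (auto simp: coeff_T coeff_eq_0 split: nat.splits)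
  then have "ore_mult \<sigma> \<delta> (T p) q
      = (\<Sum>i\<le>Suc ?n. ore_scale (coeff (T p) i) ((T ^^ i) q))"
    by (rule mult_eq_sum)
  also have "\<dots> = (\<Sum>i\<le>Suc ?n. ore_scale (case i of 0 \<Rightarrow> 0 | Suc m \<Rightarrow> \<sigma> (coeff p m)) ((T ^^ i) q))
      + (\<Sum>i\<le>Suc ?n. ore_scale (\<delta> (coeff p i)) ((T ^^ i) q))"
    by (simp only: coeff_T ore_scale_add_left sum.distrib)
  also have "(\<Sum>i\<le>Suc ?n. ore_scale (case i of 0 \<Rightarrow> 0 | Suc m \<Rightarrow> \<sigma> (coeff p m)) ((T ^^ i) q))
      = (\<Sum>i\<le>?n. ore_scale (\<sigma> (coeff p i)) (T ((T ^^ i) q)))"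
    by (subst sum.atMost_Suc_shift) simp
  also have "(\<Sum>i\<le>Suc ?n. ore_scale (\<delta> (coeff p i)) ((T ^^ i) q))
      = (\<Sum>i\<le>?n. ore_scale (\<delta> (coeff p i)) ((T ^^ i) q))"
    by (simp add: coeff_eq_0)
  finally show ?thesis
    by (simp add: ore_mult_def T_sum T_scale sum.distrib)
qed

lemma mult_assoc:
  "ore_mult \<sigma> \<delta> (ore_mult \<sigma> \<delta> p q) s = ore_mult \<sigma> \<delta> p (ore_mult \<sigma> \<delta> q s)"
proof -
  have "ore_mult \<sigma> \<delta> ((T ^^ i) q) s = (T ^^ i) (ore_mult \<sigma> \<delta> q s)" for i
    by (induction i) (simp_all add: mult_T_left)
  then show ?thesis
    by (simp add: ore_mult_def[of _ _ p] mult_sum_left mult_scale_left)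
qed

lemma X_mult_const: "ore_mult \<sigma> \<delta> [:0, 1:] [:a:] = [:\<delta> a, \<sigma> a:]"
  by (rule poly_eqI) (simp add: ore_mult_def coeff_T coeff_pCons split: nat.splits)

lemma ore_ring_is_ring: "ring (ore_ring \<sigma> \<delta>)"
proof (rule ringI)
  show "abelian_group (ore_ring \<sigma> \<delta>)"
  proof (rule abelian_groupI)
    fix x assume "x \<in> carrier (ore_ring \<sigma> \<delta>)"
    show "\<exists>y\<in>carrier (ore_ring \<sigma> \<delta>). y \<oplus>\<^bsub>ore_ring \<sigma> \<delta>\<^esub> x = \<zero>\<^bsub>ore_ring \<sigma> \<delta>\<^esub>"
      by (rule bexI[of _ "- x"]) (simp_all add: ore_ring_def)
  qed (simp_all add: ore_ring_def ac_simps)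
  show "monoid (ore_ring \<sigma> \<delta>)"
    by (rule monoidI) (auto simp: ore_ring_def mult_assoc mult_one_left mult_one_right)
qed (auto simp: ore_ring_def mult_add_left mult_add_right)

end


section \<open>Center, twosided elements and bounds\<close>

definition ring_center :: "('a, 'b) ring_scheme \<Rightarrow> 'a set" where
  "ring_center R = {z \<in> carrier R. \<forall>x\<in>carrier R. z \<otimes>\<^bsub>R\<^esub> x = x \<otimes>\<^bsub>R\<^esub> z}"

definition free_of_rank_over :: "('a, 'b) ring_scheme \<Rightarrow> 'a set \<Rightarrow> nat \<Rightarrow> bool" where
  "free_of_rank_over R C r \<longleftrightarrow>
     (\<exists>b \<in> {..<r} \<rightarrow> carrier R. \<forall>x\<in>carrier R.
        \<exists>!c. c \<in> {..<r} \<rightarrow>\<^sub>E C \<and> x = (\<Oplus>\<^bsub>R\<^esub>i\<in>{..<r}. c i \<otimes>\<^bsub>R\<^esub> b i))"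

text \<open>
  In any ring, \<open>PIdl a\<close> is by definition the \<^emph>\<open>left\<close> ideal \<open>R a\<close>, whereas the library's
  \<open>ideal\<close> and \<open>maximalideal\<close> are twosided notions.
\<close>

definition twosided_elt :: "('a, 'b) ring_scheme \<Rightarrow> 'a \<Rightarrow> bool" where
  "twosided_elt R a \<longleftrightarrow> a \<in> carrier R \<and> PIdl\<^bsub>R\<^esub> a = a <#\<^bsub>R\<^esub> carrier R"

definition prime_twosided :: "('a::zero poly, 'b) ring_scheme \<Rightarrow> 'a poly \<Rightarrow> bool" where
  "prime_twosided R p \<longleftrightarrow>
     twosided_elt R p \<and> 0 < degree p \<and> maximalideal (PIdl\<^bsub>R\<^esub> p) R"

definition is_bound_of :: "('a, 'b) ring_scheme \<Rightarrow> 'a \<Rightarrow> 'a \<Rightarrow> bool" where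
  "is_bound_of R b f \<longleftrightarrow>
     twosided_elt R b \<and> PIdl\<^bsub>R\<^esub> b \<subseteq> PIdl\<^bsub>R\<^esub> f \<and>
     (\<forall>J. ideal J R \<and> J \<subseteq> PIdl\<^bsub>R\<^esub> f \<longrightarrow> J \<subseteq> PIdl\<^bsub>R\<^esub> b)"

text \<open>
  The library's \<open>irreducible\<close> is phrased through one-sided divisibility and meant for
  commutative monoids, so the usual noncommutative notion is spelled out.
\<close>

definition irreducible_elt :: "('a, 'b) ring_scheme \<Rightarrow> 'a \<Rightarrow> bool" where
  "irreducible_elt R f \<longleftrightarrow>
     f \<in> carrier R \<and> f \<noteq> \<zero>\<^bsub>R\<^esub> \<and> f \<notin> Units R \<and>
     (\<forall>g\<in>carrier R. \<forall>h\<in>carrier R. f = g \<otimes>\<^bsub>R\<^esub> h \<longrightarrow> g \<in> Units R \<or> h \<in> Units R)"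


section \<open>Quotients by left ideals and endomorphism rings of left modules\<close>

text \<open>
  The library's module record extends the ring record; the fields \<open>mult\<close> and \<open>one\<close> carry
  no meaning for a module. Its module locale assumes a commutative base ring and is not used.
\<close>

definition left_quotient ::
    "('a, 'b) ring_scheme \<Rightarrow> 'a set \<Rightarrow> ('a, 'a set) module" where
  "left_quotient R I =
     \<lparr>carrier = a_rcosets\<^bsub>R\<^esub> I, monoid.mult = undefined, monoid.one = undefined,
      ring.zero = I, ring.add = set_add R,
      module.smult = (\<lambda>r A. \<Union>a\<in>A. I +>\<^bsub>R\<^esub> (r \<otimes>\<^bsub>R\<^esub> a))\<rparr>"

lemma left_quotient_smult:
  assumes "ring R" "f \<in> carrier R" "r \<in> carrier R" "x \<in> carrier R"
  shows "r \<odot>\<^bsub>left_quotient R (PIdl\<^bsub>R\<^esub> f)\<^esub> (PIdl\<^bsub>R\<^esub> f +>\<^bsub>R\<^esub> x)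
    = PIdl\<^bsub>R\<^esub> f +>\<^bsub>R\<^esub> (r \<otimes>\<^bsub>R\<^esub> x)"
proof -
  interpret ring R by fact
  let ?I = "PIdl\<^bsub>R\<^esub> f"
  have sub: "additive_subgroup ?I R"
  proof (intro additive_subgroup.intro add.subgroupI)
    show "?I \<subseteq> carrier R" "?I \<noteq> {}"
      using assms by (auto simp: cgenideal_def)
    show "\<ominus>\<^bsub>R\<^esub> a \<in> ?I" if "a \<in> ?I" for a
      using that assms by (auto simp: cgenideal_def) (metis a_inv_closed l_minus)
    show "a \<oplus>\<^bsub>R\<^esub> b \<in> ?I" if "a \<in> ?I" "b \<in> ?I" for a b
      using that assms by (auto simp: cgenideal_def) (metis add.m_closed l_distr)
  qed
  have abs: "abelian_subgroup ?I R"
    by (rule abelian_subgroupI3) (rule sub, rule is_abelian_group)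
  have "?I +>\<^bsub>R\<^esub> (r \<otimes>\<^bsub>R\<^esub> a) = ?I +>\<^bsub>R\<^esub> (r \<otimes>\<^bsub>R\<^esub> x)"
    if a: "a \<in> ?I +>\<^bsub>R\<^esub> x" for a
  proof -
    obtain y where y: "y \<in> carrier R" "a = y \<otimes>\<^bsub>R\<^esub> f \<oplus>\<^bsub>R\<^esub> x"
      using a unfolding a_r_coset_def' cgenideal_def by blast
    have "r \<otimes>\<^bsub>R\<^esub> a = (r \<otimes>\<^bsub>R\<^esub> y) \<otimes>\<^bsub>R\<^esub> f \<oplus>\<^bsub>R\<^esub> r \<otimes>\<^bsub>R\<^esub> x"
      using y assms by (simp add: r_distr m_assoc)
    then have "r \<otimes>\<^bsub>R\<^esub> a \<in> ?I +>\<^bsub>R\<^esub> (r \<otimes>\<^bsub>R\<^esub> x)"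
      unfolding a_r_coset_def' cgenideal_def using y(1) assms(3) by blast
    then show ?thesis
      by (metis abelian_subgroup.a_repr_independence' [OF abs] assms(3,4) m_closed)
  qed
  then have "(\<Union>a\<in>?I +>\<^bsub>R\<^esub> x. ?I +>\<^bsub>R\<^esub> (r \<otimes>\<^bsub>R\<^esub> a))
      = (\<Union>a\<in>?I +>\<^bsub>R\<^esub> x. ?I +>\<^bsub>R\<^esub> (r \<otimes>\<^bsub>R\<^esub> x))"
    by (rule SUP_cong[OF refl])
  moreover have "?I +>\<^bsub>R\<^esub> x \<noteq> {}"
    using abelian_subgroup.a_rcos_self[OF abs assms(4)] by blast
  ultimately show ?thesis
    by (simp only: left_quotient_def module.simps UN_constant if_False)
qed

text \<open>Endomorphisms are extensional outside the carrier, so that equality is meaningful.\<close>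

definition left_End ::
    "('a, 'b) ring_scheme \<Rightarrow> ('a, 'c, 'd) module_scheme \<Rightarrow> ('c \<Rightarrow> 'c) ring" where
  "left_End R M =
     \<lparr>carrier = {\<phi> \<in> carrier M \<rightarrow>\<^sub>E carrier M.
        (\<forall>x\<in>carrier M. \<forall>y\<in>carrier M. \<phi> (x \<oplus>\<^bsub>M\<^esub> y) = \<phi> x \<oplus>\<^bsub>M\<^esub> \<phi> y) \<and>
        (\<forall>r\<in>carrier R. \<forall>x\<in>carrier M. \<phi> (r \<odot>\<^bsub>M\<^esub> x) = r \<odot>\<^bsub>M\<^esub> \<phi> x)},
      monoid.mult = compose (carrier M),
      monoid.one = (\<lambda>x\<in>carrier M. x),
      ring.zero = (\<lambda>x\<in>carrier M. \<zero>\<^bsub>M\<^esub>),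
      ring.add = (\<lambda>\<phi> \<psi>. \<lambda>x\<in>carrier M. \<phi> x \<oplus>\<^bsub>M\<^esub> \<psi> x)\<rparr>"

end

theory Submission
  imports Defs
begin

text \<open>
  Let \<open>g\<close> be a right divisor of \<open>f\<close> of least positive degree, so that \<open>V = R / R g\<close> is a simple
  left \<open>R\<close>-module. As \<open>R \<pi>\<close>, \<open>\<pi> = f\<^sup>*\<close>, is a maximal twosided ideal, it is the annihilator of \<open>V\<close>.
  Choose \<open>v\<^sub>1, \<dots>, v\<^sub>n \<in> V\<close> with \<open>n\<close> maximal such that \<open>a \<mapsto> (a v\<^sub>1, \<dots>, a v\<^sub>n)\<close> maps \<open>R\<close> onto \<open>V\<^sup>n\<close>.
  By maximality the kernel is \<open>R \<pi>\<close>, whence \<open>deg \<pi> \<le> n deg g\<close>. On the other hand, the \<open>v\<^sub>i\<close> are independent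
  over the center \<open>C\<close> modulo \<open>\<pi>\<close>, and if \<open>V\<close> contains \<open>m\<close> independent elements, then \<open>R / R \<pi>\<close>
  contains \<open>n m\<close> of them, so that \<open>n m \<le> r\<close>. With \<open>m = n\<close>, the hypothesis
  \<open>deg \<pi> = \<surd>r deg f\<close> forces \<open>n\<^sup>2 = r\<close> and \<open>deg f = deg g\<close>, and \<open>f\<close> is irreducible. Moreover \<open>m = n + 1\<close>
  is impossible, so every element of \<open>V\<close> has a nonzero central multiple in the \<open>C\<close>-span of the
  \<open>v\<^sub>i\<close>. Applied to the image of \<open>v\<^sub>1\<close> under an endomorphism \<open>\<phi>\<close>, and combined with some \<open>a\<close> that
  fixes \<open>v\<^sub>1\<close> and kills the other \<open>v\<^sub>i\<close>, this gives \<open>c \<phi> = d\<close> with \<open>c\<close>, \<open>d\<close> central and \<open>c\<close>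
  injective on \<open>V\<close>. Such endomorphisms commute.
\<close>

section \<open>Endomorphism rings\<close>

text \<open>Supplies the ring axioms contained in \<open>cring\<close>: zero, sums and negatives of
  linear maps stay linear because each scalar acts additively.\<close>

lemma ring_left_End:
  fixes R :: "('a, 'b) ring_scheme" and M :: "('a, 'c, 'd) module_scheme"
  assumes M: "abelian_group M"
    and closed: "\<And>a x. a \<in> carrier R \<Longrightarrow> x \<in> carrier M \<Longrightarrow> a \<odot>\<^bsub>M\<^esub> x \<in> carrier M"
    and distrib: "\<And>a x y. a \<in> carrier R \<Longrightarrow> x \<in> carrier M \<Longrightarrow> y \<in> carrier M \<Longrightarrow>
      a \<odot>\<^bsub>M\<^esub> (x \<oplus>\<^bsub>M\<^esub> y) = a \<odot>\<^bsub>M\<^esub> x \<oplus>\<^bsub>M\<^esub> a \<odot>\<^bsub>M\<^esub> y"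
  shows "ring (left_End R M)"
proof -
  interpret M: abelian_group M by (rule M)
  let ?E = "left_End R M"
  have mem: "\<phi> \<in> carrier ?E \<longleftrightarrow> \<phi> \<in> extensional (carrier M) \<and>
      (\<forall>x\<in>carrier M. \<phi> x \<in> carrier M) \<and>
      (\<forall>x\<in>carrier M. \<forall>y\<in>carrier M. \<phi> (x \<oplus>\<^bsub>M\<^esub> y) = \<phi> x \<oplus>\<^bsub>M\<^esub> \<phi> y) \<and>
      (\<forall>a\<in>carrier R. \<forall>x\<in>carrier M. \<phi> (a \<odot>\<^bsub>M\<^esub> x) = a \<odot>\<^bsub>M\<^esub> \<phi> x)" for \<phi>
    by (auto simp: left_End_def PiE_iff)
  have add: "\<phi> \<oplus>\<^bsub>?E\<^esub> \<psi> = (\<lambda>x\<in>carrier M. \<phi> x \<oplus>\<^bsub>M\<^esub> \<psi> x)" for \<phi> \<psi>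
    by (simp add: left_End_def)
  have mult: "\<phi> \<otimes>\<^bsub>?E\<^esub> \<psi> = (\<lambda>x\<in>carrier M. \<phi> (\<psi> x))" for \<phi> \<psi>
    by (simp add: left_End_def compose_def)
  have zero: "\<zero>\<^bsub>?E\<^esub> = (\<lambda>x\<in>carrier M. \<zero>\<^bsub>M\<^esub>)" and one: "\<one>\<^bsub>?E\<^esub> = (\<lambda>x\<in>carrier M. x)"
    by (simp_all add: left_End_def)
  have smult_zero: "a \<odot>\<^bsub>M\<^esub> \<zero>\<^bsub>M\<^esub> = \<zero>\<^bsub>M\<^esub>" if "a \<in> carrier R" for a
    using distrib[OF that M.zero_closed M.zero_closed] closed[OF that M.zero_closed]
    by (metis M.add.r_cancel_one M.r_zero M.zero_closed)
  have smult_neg: "a \<odot>\<^bsub>M\<^esub> (\<ominus>\<^bsub>M\<^esub> x) = \<ominus>\<^bsub>M\<^esub> (a \<odot>\<^bsub>M\<^esub> x)" if "a \<in> carrier R" "x \<in> carrier M" for a x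
  proof -
    have "a \<odot>\<^bsub>M\<^esub> (\<ominus>\<^bsub>M\<^esub> x) \<oplus>\<^bsub>M\<^esub> a \<odot>\<^bsub>M\<^esub> x = \<zero>\<^bsub>M\<^esub>"
      using distrib[of a "\<ominus>\<^bsub>M\<^esub> x" x] that by (simp add: M.l_neg smult_zero)
    then show ?thesis using that closed by (metis M.a_inv_closed M.minus_equality)
  qed
  show ?thesis
  proof (rule ringI)
    show "abelian_group ?E"
    proof (rule abelian_groupI)
      fix \<phi> assume \<phi>: "\<phi> \<in> carrier ?E"
      show "\<exists>\<psi>\<in>carrier ?E. \<psi> \<oplus>\<^bsub>?E\<^esub> \<phi> = \<zero>\<^bsub>?E\<^esub>"
      proof (rule bexI)
        show "(\<lambda>x\<in>carrier M. \<ominus>\<^bsub>M\<^esub> \<phi> x) \<in> carrier ?E"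
          using \<phi> by (auto simp: mem closed smult_neg M.minus_add)
        show "(\<lambda>x\<in>carrier M. \<ominus>\<^bsub>M\<^esub> \<phi> x) \<oplus>\<^bsub>?E\<^esub> \<phi> = \<zero>\<^bsub>?E\<^esub>"
          using \<phi> by (auto simp: mem add zero M.l_neg intro!: restrict_ext)
      qed
      show "\<zero>\<^bsub>?E\<^esub> \<oplus>\<^bsub>?E\<^esub> \<phi> = \<phi>"
        using \<phi> by (auto simp: mem add zero intro!: extensionalityI[of _ "carrier M"])
    next
      fix \<phi> \<psi> assume "\<phi> \<in> carrier ?E" "\<psi> \<in> carrier ?E"
      then show "\<phi> \<oplus>\<^bsub>?E\<^esub> \<psi> \<in> carrier ?E" "\<phi> \<oplus>\<^bsub>?E\<^esub> \<psi> = \<psi> \<oplus>\<^bsub>?E\<^esub> \<phi>"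
        by (auto simp: mem add closed distrib M.a_ac intro!: restrict_ext)
    next
      fix \<phi> \<psi> \<chi> assume "\<phi> \<in> carrier ?E" "\<psi> \<in> carrier ?E" "\<chi> \<in> carrier ?E"
      then show "\<phi> \<oplus>\<^bsub>?E\<^esub> \<psi> \<oplus>\<^bsub>?E\<^esub> \<chi> = \<phi> \<oplus>\<^bsub>?E\<^esub> (\<psi> \<oplus>\<^bsub>?E\<^esub> \<chi>)"
        by (auto simp: mem add M.a_assoc intro!: restrict_ext)
    qed (auto simp: mem zero closed smult_zero)
    show "monoid ?E"
      by (rule monoidI)
        (auto simp: mem mult one closed intro!: restrict_ext extensionalityI[of _ "carrier M"])
  qed (auto simp: mem add mult intro!: restrict_ext)
qed

section \<open>Division and the center of an Ore polynomial ring\<close>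

context ore_data
begin

abbreviation mul :: "'a poly \<Rightarrow> 'a poly \<Rightarrow> 'a poly" (infixl "\<star>" 70)
  where "p \<star> q \<equiv> ore_mult \<sigma> \<delta> p q"

abbreviation left_multiples :: "'a poly \<Rightarrow> 'a poly set" where
  "left_multiples g \<equiv> range (\<lambda>q. q \<star> g)"

lemma mult_0_right [simp]: "p \<star> 0 = 0"
  using mult_add_right[of p 0 0] by simp

lemma mult_minus_left: "(- p) \<star> q = - (p \<star> q)"
  using mult_add_left[of "- p" p q] by (simp add: eq_neg_iff_add_eq_0)

lemma mult_minus_right: "p \<star> (- q) = - (p \<star> q)"
  using mult_add_right[of p "- q" q] by (simp add: eq_neg_iff_add_eq_0)

lemma mult_diff_left: "(p - p') \<star> q = p \<star> q - p' \<star> q"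
  using mult_add_left[of p "- p'" q] by (simp add: mult_minus_left)

lemma mult_diff_right: "p \<star> (q - q') = p \<star> q - p \<star> q'"
  using mult_add_right[of p q "- q'"] by (simp add: mult_minus_right)

lemma mult_sum_right: "p \<star> (\<Sum>i\<in>A. g i) = (\<Sum>i\<in>A. p \<star> g i)"
  by (induction A rule: infinite_finite_induct) (simp_all add: mult_add_right)

section \<open>Degrees, right division and common left multiples\<close>

lemma sigma_pow_0 [simp]: "(\<sigma> ^^ n) 0 = 0"
  by (induction n) simp_all

lemma sigma_eq_0_iff [simp]: "\<sigma> a = 0 \<longleftrightarrow> a = 0"
  using automorphism unfolding ring_automorphism_def bij_def by (metis injD sigma_0)

lemma sigma_pow_eq_0_iff [simp]: "(\<sigma> ^^ n) a = 0 \<longleftrightarrow> a = 0"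
  by (induction n) simp_all

lemma coeff_Tn_above: "degree q + i < n \<Longrightarrow> coeff ((T ^^ i) q) n = 0"
  by (induction i arbitrary: n) (auto simp: coeff_T coeff_eq_0 split: nat.splits)

lemma coeff_Tn_top: "coeff ((T ^^ i) q) (degree q + i) = (\<sigma> ^^ i) (lead_coeff q)"
  by (induction i) (simp_all add: coeff_T coeff_Tn_above)

lemma coeff_mult_above:
  assumes "degree p + degree q < n"
  shows "coeff (p \<star> q) n = 0"
proof -
  have "coeff p i * coeff ((T ^^ i) q) n = 0" if "i \<le> degree p" for i
    using coeff_Tn_above[of q i n] assms that by simp
  then show ?thesis unfolding ore_mult_def coeff_sum coeff_ore_scale by (intro sum.neutral) auto
qed

text \<open>Only the summand with \<open>i = degree p\<close> reaches this degree, and carrying a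
  coefficient past \<open>X\<close> applies \<sigma> once. As \<sigma> is injective, it follows that
  degrees add and there are no zero divisors.\<close>

lemma coeff_mult_top:
  "coeff (p \<star> q) (degree p + degree q) = lead_coeff p * (\<sigma> ^^ degree p) (lead_coeff q)"
proof -
  have "coeff (p \<star> q) (degree p + degree q)
      = (\<Sum>i\<le>degree p. coeff p i * coeff ((T ^^ i) q) (degree p + degree q))"
    by (simp add: ore_mult_def coeff_sum)
  also have "\<dots> = (\<Sum>i\<in>{degree p}. coeff p i * coeff ((T ^^ i) q) (degree p + degree q))"
  proof (rule sum.mono_neutral_right)
    show "\<forall>i\<in>{..degree p} - {degree p}. coeff p i * coeff ((T ^^ i) q) (degree p + degree q) = 0"
      by (auto intro!: coeff_Tn_above)
  qed auto
  also have "\<dots> = lead_coeff p * (\<sigma> ^^ degree p) (lead_coeff q)"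
    using coeff_Tn_top[of "degree p" q] by (simp add: add.commute)
  finally show ?thesis .
qed

lemma degree_mult:
  assumes "p \<noteq> 0" "q \<noteq> 0"
  shows "degree (p \<star> q) = degree p + degree q"
proof (rule antisym)
  show "degree (p \<star> q) \<le> degree p + degree q"
    by (rule degree_le) (use coeff_mult_above in blast)
  show "degree p + degree q \<le> degree (p \<star> q)"
    by (rule le_degree) (use assms in \<open>simp add: coeff_mult_top\<close>)
qed

lemma mult_eq_0_iff [simp]: "p \<star> q = 0 \<longleftrightarrow> p = 0 \<or> q = 0"
proof -
  have False if "p \<noteq> 0" "q \<noteq> 0" "p \<star> q = 0"
    using that coeff_mult_top[of p q] by simp
  then show ?thesis by auto
qed

lemma mult_right_cancel: "c \<noteq> 0 \<Longrightarrow> p \<star> c = q \<star> c \<Longrightarrow> p = q"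
  using mult_diff_left[of p q c] by simp

lemma right_division:
  assumes "g \<noteq> 0"
  shows "\<exists>q. p - q \<star> g = 0 \<or> degree (p - q \<star> g) < degree g"
proof (induction "degree p" arbitrary: p rule: less_induct)
  case less
  show ?case
  proof (cases "p = 0 \<or> degree p < degree g")
    case True
    then show ?thesis by (intro exI[of _ 0]) simp
  next
    case False
    define k where "k = degree p - degree g"
    \<comment> \<open>Moving a coefficient past \<open>X^k\<close> applies \<sigma> k times, hence
      the twisted inverse: \<open>q \<star> g\<close> gets the leading term of
      \<open>p\<close>.\<close>
    define q where "q = monom (lead_coeff p * inverse ((\<sigma> ^^ k) (lead_coeff g))) k"
    have q: "q \<noteq> 0" "degree q = k" "lead_coeff q = lead_coeff p * inverse ((\<sigma> ^^ k) (lead_coeff g))"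
      using False assms by (simp_all add: q_def monom_eq_0_iff degree_monom_eq)
    have d: "degree (q \<star> g) = degree p"
      using False q assms by (simp add: degree_mult k_def)
    have "coeff (q \<star> g) (degree p) = lead_coeff p"
      using coeff_mult_top[of q g] q False assms by (simp add: k_def mult.assoc)
    then have c: "coeff (p - q \<star> g) (degree p) = 0" by simp
    have "degree (p - q \<star> g) \<le> degree p"
      using d by (metis degree_diff_le_max max.idem)
    then have "p - q \<star> g = 0 \<or> degree (p - q \<star> g) < degree p"
      using c by (metis le_neq_implies_less leading_coeff_0_iff)
    then show ?thesis
    proof
      assume "degree (p - q \<star> g) < degree p"
      from less[OF this] obtain q' where
        "p - q \<star> g - q' \<star> g = 0 \<or> degree (p - q \<star> g - q' \<star> g) < degree g" by blast
      then show ?thesis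
        by (intro exI[of _ "q + q'"]) (simp add: mult_add_left algebra_simps)
    qed blast
  qed
qed

lemma degree_0_invertible:
  assumes "u \<noteq> 0" "degree u = 0"
  shows "\<exists>v. v \<star> u = [:1:] \<and> u \<star> v = [:1:]"
proof -
  obtain a where a: "u = [:a:]" using assms(2) degree_eq_zeroE by blast
  with assms(1) have "a \<noteq> 0" by auto
  then show ?thesis
    by (intro exI[of _ "[:inverse a:]"]) (auto simp: a ore_mult_def intro!: poly_eqI split: nat.splits simp: coeff_pCons)
qed

text \<open>The Euclidean algorithm, with divisor and remainder exchanging roles. The degree bound
  is the point: each element of \<open>R / R g\<close> is killed by a nonzero polynomial of degree
  at most \<open>degree g\<close>.\<close>

lemma common_left_multiple:
  assumes "g \<noteq> 0"
  shows "\<exists>a b. a \<noteq> 0 \<and> degree a \<le> degree g \<and> a \<star> p = b \<star> g"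
  using assms
proof (induction "degree g" arbitrary: g p rule: less_induct)
  case less
  obtain q where q: "p - q \<star> g = 0 \<or> degree (p - q \<star> g) < degree g"
    using right_division[OF less.prems] by blast
  define s where "s = p - q \<star> g"
  have p: "p = q \<star> g + s" by (simp add: s_def)
  show ?case
  proof (cases "s = 0")
    case True
    then show ?thesis
      by (intro exI[of _ "[:1:]"] exI[of _ q]) (simp add: p mult_one_left)
  next
    case False
    with q have "degree s < degree g" by (simp add: s_def)
    from less.hyps[OF this False] obtain b a where
      b: "b \<noteq> 0" "degree b \<le> degree s" "b \<star> g = a \<star> s" by blast
    have a: "a \<noteq> 0" using b less.prems by (metis mult_eq_0_iff)
    \<comment> \<open>Equating degrees in \<open>b \<star> g = a \<star> s\<close> transfers the
      bound on \<open>b\<close> to \<open>a\<close>.\<close>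
    have "degree a + degree s = degree b + degree g"
      using a b False less.prems by (metis degree_mult)
    then have "degree a \<le> degree g" using b(2) by simp
    moreover have "a \<star> p = (a \<star> q + b) \<star> g"
      by (simp add: p mult_add_right mult_add_left mult_assoc b(3))
    ultimately show ?thesis using a by blast
  qed
qed

text \<open>Annihilators are multiplied one after the other, each new one being taken for the image
  of \<open>v n\<close> under the product so far. For a faithful family this will bound
  \<open>degree fstar\<close> by \<open>n * degree g\<close>.\<close>

lemma common_annihilator:
  assumes "g \<noteq> 0"
  shows "\<exists>h. h \<noteq> 0 \<and> degree h \<le> n * degree g \<and> (\<forall>i<n. \<exists>b. h \<star> v i = b \<star> g)"
proof (induction n)
  case 0
  show ?case by (intro exI[of _ "[:1:]"]) simp
next
  case (Suc n)
  then obtain h where h: "h \<noteq> 0" "degree h \<le> n * degree g" "\<forall>i<n. \<exists>b. h \<star> v i = b \<star> g"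
    by blast
  obtain a b where a: "a \<noteq> 0" "degree a \<le> degree g" "a \<star> (h \<star> v n) = b \<star> g"
    using common_left_multiple[OF assms] by blast
  have "degree (a \<star> h) \<le> Suc n * degree g"
    using a h by (simp add: degree_mult)
  moreover have "\<exists>b. (a \<star> h) \<star> v i = b \<star> g" if "i < Suc n" for i
  proof (cases "i = n")
    case True
    with a show ?thesis by (auto simp: mult_assoc)
  next
    case False
    with that h(3) obtain c where "h \<star> v i = c \<star> g" by (metis less_SucE)
    then show ?thesis by (metis mult_assoc)
  qed
  ultimately show ?case using a h by (intro exI[of _ "a \<star> h"]) auto
qed

section \<open>The center and linear dependence over it\<close>

definition center :: "'a poly set" where
  "center = {c. \<forall>x. c \<star> x = x \<star> c}"

lemma centerD: "c \<in> center \<Longrightarrow> c \<star> x = x \<star> c"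
  by (simp add: center_def)

lemma center_left_commute: "c \<in> center \<Longrightarrow> x \<star> (c \<star> y) = c \<star> (x \<star> y)"
  by (metis centerD mult_assoc)

lemma center_0 [simp]: "0 \<in> center"
  and center_1 [simp]: "[:1:] \<in> center"
  by (simp_all add: center_def mult_one_left mult_one_right)

lemma center_minus: "c \<in> center \<Longrightarrow> - c \<in> center"
  by (simp add: center_def mult_minus_left mult_minus_right)

lemma center_add: "c \<in> center \<Longrightarrow> d \<in> center \<Longrightarrow> c + d \<in> center"
  by (simp add: center_def mult_add_left mult_add_right)

lemma center_diff: "c \<in> center \<Longrightarrow> d \<in> center \<Longrightarrow> c - d \<in> center"
  by (simp add: center_def mult_diff_left mult_diff_right)

lemma center_mult:
  assumes "c \<in> center" "d \<in> center"
  shows "c \<star> d \<in> center"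
proof -
  have "(c \<star> d) \<star> x = x \<star> (c \<star> d)" for x
    using assms by (metis centerD mult_assoc)
  then show ?thesis by (simp add: center_def)
qed

lemma center_sum: "(\<And>i. i \<in> A \<Longrightarrow> c i \<in> center) \<Longrightarrow> (\<Sum>i\<in>A. c i) \<in> center"
  by (induction A rule: infinite_finite_induct) (simp_all add: center_add)

text \<open>The central factor \<open>z\<close> moves past \<open>x\<close> and cancels on the
  right. This allows \<open>z\<close> to be divided out of a central relation.\<close>

lemma center_cofactor:
  assumes "d \<star> z \<in> center" "z \<in> center" "z \<noteq> 0"
  shows "d \<in> center"
proof -
  have "(d \<star> x) \<star> z = (x \<star> d) \<star> z" for x
    using centerD[OF assms(1), of x] centerD[OF assms(2), of x] by (simp add: mult_assoc)
  then show ?thesis using mult_right_cancel[OF assms(3)] by (simp add: center_def)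
qed

text \<open>Fraction-free elimination, since the center is a domain but not a field.\<close>

lemma center_linear_dependence:
  assumes "finite I" "r < card I" "\<And>i j. M i j \<in> center"
  shows "\<exists>c. (\<forall>i. c i \<in> center) \<and> (\<exists>i\<in>I. c i \<noteq> 0) \<and> (\<forall>j<r. (\<Sum>i\<in>I. c i \<star> M i j) = 0)"
  using assms
proof (induction r arbitrary: I M)
  case 0
  then have "I \<noteq> {}" by auto
  then show ?case by (intro exI[of _ "\<lambda>_. [:1:]"]) auto
next
  case (Suc r)
  show ?case
  proof (cases "\<exists>k\<in>I. M k r \<noteq> 0")
    case False
    from Suc.IH[of I M] Suc.prems obtain c where
      c: "\<forall>i. c i \<in> center" "\<exists>i\<in>I. c i \<noteq> 0" "\<forall>j<r. (\<Sum>i\<in>I. c i \<star> M i j) = 0"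
      by auto
    moreover have "(\<Sum>i\<in>I. c i \<star> M i r) = 0"
      using False by (intro sum.neutral) auto
    ultimately show ?thesis by (intro exI[of _ c]) (auto simp: less_Suc_eq)
  next
    case True
    then obtain k where k: "k \<in> I" "M k r \<noteq> 0" by blast
    define I' where "I' = I - {k}"
    have I': "finite I'" "k \<notin> I'" "I = insert k I'" "r < card I'"
      using Suc.prems k by (auto simp: I'_def)
    \<comment> \<open>Row \<open>k\<close> supplies the pivot \<open>M k r\<close>. Column
      \<open>r\<close> of \<open>M'\<close> vanishes because central entries commute.\<close>
    define M' where "M' i j = M k r \<star> M i j - M i r \<star> M k j" for i j
    have "M' i j \<in> center" for i j
      unfolding M'_def using Suc.prems(3) by (intro center_diff center_mult)
    from Suc.IH[of I' M', OF I'(1,4) this] obtain c where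
      c: "\<forall>i. c i \<in> center" "\<exists>i\<in>I'. c i \<noteq> 0" "\<forall>j<r. (\<Sum>i\<in>I'. c i \<star> M' i j) = 0" by blast
    \<comment> \<open>The coefficient of the pivot row is forced: with it a relation for
      \<open>M'\<close> becomes one for \<open>M\<close>. A nonzero \<open>c i\<close> stays nonzero
      when multiplied by the pivot.\<close>
    define d where "d i = (if i = k then - (\<Sum>i\<in>I'. c i \<star> M i r) else c i \<star> M k r)" for i
    have eq: "(\<Sum>i\<in>I. d i \<star> M i j) = (\<Sum>i\<in>I'. c i \<star> M' i j)" for j
    proof -
      have "(\<Sum>i\<in>I. d i \<star> M i j)
          = - (\<Sum>i\<in>I'. c i \<star> M i r) \<star> M k j + (\<Sum>i\<in>I'. d i \<star> M i j)"
        using I' by (simp add: d_def)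
      also have "(\<Sum>i\<in>I'. d i \<star> M i j) = (\<Sum>i\<in>I'. c i \<star> (M k r \<star> M i j))"
        using I' by (intro sum.cong) (auto simp: d_def mult_assoc)
      also have "- (\<Sum>i\<in>I'. c i \<star> M i r) \<star> M k j = - (\<Sum>i\<in>I'. c i \<star> (M i r \<star> M k j))"
        by (simp add: mult_minus_left mult_sum_left mult_assoc)
      finally show ?thesis
        by (simp add: M'_def mult_diff_right sum_subtractf)
    qed
    have "M' i r = 0" for i
      using Suc.prems(3) by (simp add: M'_def centerD)
    then have "\<forall>j<Suc r. (\<Sum>i\<in>I. d i \<star> M i j) = 0"
      using c(3) by (auto simp: eq less_Suc_eq)
    moreover have "d i \<in> center" for i
      unfolding d_def using c(1) Suc.prems(3) by (auto intro!: center_minus center_sum center_mult)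
    moreover have "\<exists>i\<in>I. d i \<noteq> 0"
      using c(2) I' k by (auto simp: d_def)
    ultimately show ?thesis by blast
  qed
qed

section \<open>The ring record in polynomial terms, and relations from finite rank\<close>

lemma ring_center_eq: "ring_center (ore_ring \<sigma> \<delta>) = center"
  by (auto simp: ring_center_def center_def ore_ring_def)

lemma PIdl_eq: "PIdl\<^bsub>ore_ring \<sigma> \<delta>\<^esub> g = left_multiples g"
  by (auto simp: cgenideal_def ore_ring_def)

lemma carrier_ore_ring [simp]: "carrier (ore_ring \<sigma> \<delta>) = UNIV"
  and mult_ore_ring: "monoid.mult (ore_ring \<sigma> \<delta>) = (\<star>)"
  and one_ore_ring: "\<one>\<^bsub>ore_ring \<sigma> \<delta>\<^esub> = [:1:]"
  and zero_ore_ring: "\<zero>\<^bsub>ore_ring \<sigma> \<delta>\<^esub> = 0"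
  and add_ore_ring: "ring.add (ore_ring \<sigma> \<delta>) = (+)"
  by (simp_all add: ore_ring_def)

lemma finsum_eq_sum:
  assumes "finite A"
  shows "finsum (ore_ring \<sigma> \<delta>) g A = (\<Sum>i\<in>A. g i)"
  using assms
proof (induction A rule: finite_induct)
  case empty
  interpret ring "ore_ring \<sigma> \<delta>" by (rule ore_ring_is_ring)
  show ?case unfolding finsum_empty by (simp add: zero_ore_ring)
next
  case (insert x F)
  interpret ring "ore_ring \<sigma> \<delta>" by (rule ore_ring_is_ring)
  have "g \<in> F \<rightarrow> carrier (ore_ring \<sigma> \<delta>)" "g x \<in> carrier (ore_ring \<sigma> \<delta>)"
    by simp_all
  from finsum_insert[OF insert.hyps this] show ?case
    unfolding insert.IH sum.insert[OF insert.hyps] add_ore_ring .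
qed

text \<open>Coordinates in a basis form a matrix with \<open>r\<close> columns and more than
  \<open>r\<close> rows; a central relation between its rows is one between the
  \<open>x i\<close>.\<close>

lemma rank_dependence:
  assumes free: "free_of_rank_over (ore_ring \<sigma> \<delta>) (ring_center (ore_ring \<sigma> \<delta>)) r"
    and I: "finite I" "r < card I"
  shows "\<exists>c. (\<forall>i. c i \<in> center) \<and> (\<exists>i\<in>I. c i \<noteq> 0) \<and> (\<Sum>i\<in>I. c i \<star> x i) = 0"
proof -
  let ?R = "ore_ring \<sigma> \<delta>"
  obtain b where b: "\<forall>x\<in>carrier ?R. \<exists>!c. c \<in> {..<r} \<rightarrow>\<^sub>E center \<and>
      x = (\<Oplus>\<^bsub>?R\<^esub>i\<in>{..<r}. c i \<otimes>\<^bsub>?R\<^esub> b i)"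
    using free unfolding free_of_rank_over_def ring_center_eq by (elim bexE)
  have "\<exists>m. (\<forall>j. m j \<in> center) \<and> y = (\<Sum>j<r. m j \<star> b j)" for y
  proof -
    from ex1_implies_ex[OF bspec[OF b, of y]] obtain c
      where c: "c \<in> {..<r} \<rightarrow>\<^sub>E center" "y = (\<Sum>j<r. c j \<star> b j)"
      unfolding finsum_eq_sum[OF finite_lessThan] mult_ore_ring by auto
    \<comment> \<open>The extensional \<open>c\<close> is undefined beyond \<open>r\<close>; padding
      with 0 makes every matrix entry central, as the elimination requires.\<close>
    have "y = (\<Sum>j<r. (if j < r then c j else 0) \<star> b j)"
      unfolding c(2) by (rule sum.cong) simp_all
    moreover have "\<forall>j. (if j < r then c j else 0) \<in> center"
      using c(1) by (auto simp: PiE_iff)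
    ultimately show ?thesis by (intro exI conjI)
  qed
  then have "\<forall>i. \<exists>m. (\<forall>j. m j \<in> center) \<and> x i = (\<Sum>j<r. m j \<star> b j)" ..
  from choice[OF this] obtain M where
    "\<forall>i. (\<forall>j. M i j \<in> center) \<and> x i = (\<Sum>j<r. M i j \<star> b j)" ..
  then have M: "\<And>i j. M i j \<in> center" "\<And>i. x i = (\<Sum>j<r. M i j \<star> b j)"
    by simp_all
  obtain c where c: "\<forall>i. c i \<in> center" "\<exists>i\<in>I. c i \<noteq> 0" "\<forall>j<r. (\<Sum>i\<in>I. c i \<star> M i j) = 0"
    using center_linear_dependence[of I r M, OF I M(1)] by (elim exE conjE)
  have "(\<Sum>i\<in>I. c i \<star> x i) = (\<Sum>i\<in>I. \<Sum>j<r. (c i \<star> M i j) \<star> b j)"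
    unfolding M(2) mult_sum_right mult_assoc ..
  also have "\<dots> = (\<Sum>j<r. (\<Sum>i\<in>I. c i \<star> M i j) \<star> b j)"
    by (subst sum.swap) (simp add: mult_sum_left)
  also have "\<dots> = 0" using c(3) by simp
  finally show ?thesis using c(1,2) by (intro exI conjI)
qed

text \<open>A relation of minimal degree cannot have all its coefficients divisible by \<open>z\<close>,
  as \<open>z\<close> could be cancelled.\<close>

lemma rank_dependence_mod:
  assumes free: "free_of_rank_over (ore_ring \<sigma> \<delta>) (ring_center (ore_ring \<sigma> \<delta>)) r"
    and I: "finite I" "r < card I"
    and z: "z \<in> center" "0 < degree z"
  shows "\<exists>c. (\<forall>i. c i \<in> center) \<and> (\<exists>i\<in>I. c i \<notin> left_multiples z) \<and> (\<Sum>i\<in>I. c i \<star> x i) = 0"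
proof -
  have z0: "z \<noteq> 0" using z by auto
  have "\<exists>c. (\<forall>i. c i \<in> center) \<and> (\<exists>i\<in>I. c i \<notin> left_multiples z) \<and> (\<Sum>i\<in>I. c i \<star> x i) = 0"
    if "k \<in> I" "c k \<noteq> 0" "\<forall>i. c i \<in> center" "(\<Sum>i\<in>I. c i \<star> x i) = 0" for c k
    using that
  proof (induction "degree (c k)" arbitrary: c rule: less_induct)
    case less
    show ?case
    proof (cases "\<exists>i\<in>I. c i \<notin> left_multiples z")
      case True
      with less.prems show ?thesis by (intro exI conjI)
    next
      case False
      then have "\<forall>i\<in>I. \<exists>q. c i = q \<star> z" by blast
      from bchoice[OF this] obtain q where q: "\<forall>i\<in>I. c i = q i \<star> z" ..
      define d where "d i = (if i \<in> I then q i else 0)" for i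
      have dc: "c i = d i \<star> z" if "i \<in> I" for i
        using bspec[OF q that] that by (simp only: d_def if_True)
      have cen: "\<forall>i. d i \<in> center"
      proof
        fix i
        have "d i \<in> center" if "i \<in> I"
          using less.prems(3) dc[OF that, symmetric] by - (rule center_cofactor[OF _ z(1) z0, of "d i"], simp)
        then show "d i \<in> center" by (cases "i \<in> I") (simp_all add: d_def)
      qed
      \<comment> \<open>Being central, \<open>z\<close> can leave each summand on the right, so that
        it cancels from the whole relation.\<close>
      have "(\<Sum>i\<in>I. d i \<star> x i) \<star> z = (\<Sum>i\<in>I. c i \<star> x i)"
        unfolding mult_sum_left
      proof (rule sum.cong)
        show "d i \<star> x i \<star> z = c i \<star> x i" if "i \<in> I" for i
          unfolding dc[OF that] mult_assoc centerD[OF z(1)] ..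
      qed simp
      then have rel: "(\<Sum>i\<in>I. d i \<star> x i) = 0"
        unfolding less.prems(4) mult_eq_0_iff using z0 by simp
      have dk: "d k \<noteq> 0" using dc[OF less.prems(1)] less.prems(2) by auto
      \<comment> \<open>The positive degree of \<open>z\<close> makes the degree of the tracked
        coefficient drop.\<close>
      have "degree (d k) < degree (c k)"
        unfolding dc[OF less.prems(1)] degree_mult[OF dk z0] using z(2) by simp
      from less.hyps[OF this less.prems(1) dk cen rel] show ?thesis .
    qed
  qed
  note reduce = this
  obtain c k where "\<forall>i. c i \<in> center" "k \<in> I" "c k \<noteq> 0" "(\<Sum>i\<in>I. c i \<star> x i) = 0"
    using rank_dependence[OF free I, of x] by (elim exE conjE bexE)
  then show ?thesis by (intro reduce)
qed

end

section \<open>Simple quotients\<close>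

text \<open>The last assumption says that \<open>R p + I\<close> is all of \<open>R\<close> whenever
  \<open>p\<close> is outside \<open>I\<close>; with \<open>one_notin\<close> it makes
  \<open>R / I\<close> a simple left module.\<close>

locale ore_maximal_left_ideal = ore_data +
  fixes I :: "'a poly set"
  assumes add_mem: "x \<in> I \<Longrightarrow> y \<in> I \<Longrightarrow> x + y \<in> I"
    and mult_mem: "x \<in> I \<Longrightarrow> a \<star> x \<in> I"
    and one_notin: "[:1:] \<notin> I"
    and maximal: "p \<notin> I \<Longrightarrow> \<exists>u. u \<star> p - [:1:] \<in> I"
begin

section \<open>Congruence and annihilator modulo a maximal left ideal\<close>

lemma zero_mem [simp]: "0 \<in> I"
  by (metis maximal mult_mem mult_0_left)

lemma minus_mem: "x \<in> I \<Longrightarrow> - x \<in> I"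
  by (metis mult_mem mult_minus_left mult_one_left)

lemma sum_mem: "(\<And>i. i \<in> A \<Longrightarrow> g i \<in> I) \<Longrightarrow> (\<Sum>i\<in>A. g i) \<in> I"
  by (induction A rule: infinite_finite_induct) (simp_all add: add_mem)

definition left_cong :: "'a poly \<Rightarrow> 'a poly \<Rightarrow> bool" (infix "\<doteq>" 50) where
  "p \<doteq> q \<longleftrightarrow> p - q \<in> I"

lemma cong_refl [simp]: "p \<doteq> p"
  by (simp add: left_cong_def)

lemma cong_sym: "p \<doteq> q \<Longrightarrow> q \<doteq> p"
  using minus_mem[of "p - q"] by (simp add: left_cong_def)

lemma cong_trans [trans]: "p \<doteq> q \<Longrightarrow> q \<doteq> s \<Longrightarrow> p \<doteq> s"
  using add_mem[of "p - q" "q - s"] by (simp add: left_cong_def)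

lemma cong_mult: "p \<doteq> q \<Longrightarrow> a \<star> p \<doteq> a \<star> q"
  using mult_mem[of "p - q" a] by (simp add: left_cong_def mult_diff_right)

lemma cong_0_iff: "p \<doteq> 0 \<longleftrightarrow> p \<in> I"
  by (simp add: left_cong_def)

lemma cong_mem: "p \<doteq> q \<Longrightarrow> q \<in> I \<Longrightarrow> p \<in> I"
  by (metis cong_0_iff cong_trans)

text \<open>Simplicity of \<open>R / I\<close> in terms of representatives: scale
  \<open>u \<star> p \<doteq> [:1:]\<close> by \<open>w\<close>.\<close>

lemma generates:
  assumes "p \<notin> I"
  shows "\<exists>u. u \<star> p \<doteq> w"
proof -
  obtain u where "u \<star> p \<doteq> [:1:]" using maximal[OF assms] by (auto simp: left_cong_def)
  from cong_mult[OF this, of w] show ?thesis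
    by (intro exI[of _ "w \<star> u"]) (simp add: mult_assoc mult_one_right)
qed

definition Ann :: "'a poly set" where
  "Ann = {a. \<forall>p. a \<star> p \<in> I}"

lemma one_notin_Ann: "[:1:] \<notin> Ann"
  using one_notin by (auto simp: Ann_def mult_one_left)

text \<open>A central element acts on \<open>R / I\<close> as a module endomorphism, so killing the
  generator \<open>p\<close> it kills everything. Hence central elements outside \<open>Ann\<close>
  act injectively.\<close>

lemma center_in_Ann:
  assumes "c \<in> center" "c \<star> p \<in> I" "p \<notin> I"
  shows "c \<in> Ann"
  unfolding Ann_def
proof (intro CollectI allI)
  fix x
  obtain u where "u \<star> p \<doteq> x" using generates[OF assms(3)] by blast
  then have "x \<doteq> u \<star> p" by (rule cong_sym)
  then have "c \<star> x \<doteq> c \<star> (u \<star> p)" by (rule cong_mult)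
  also have "c \<star> (u \<star> p) = u \<star> (c \<star> p)" by (simp add: center_left_commute[OF assms(1)])
  finally show "c \<star> x \<in> I" by (rule cong_mem) (rule mult_mem[OF assms(2)])
qed

text \<open>Surjectivity of \<open>a \<mapsto> (a v\<^sub>0, \<dots>, a v\<^sub>n\<^sub>-\<^sub>1)\<close> from \<open>R\<close> to \<open>(R / I)\<^sup>n\<close>. By density, this
  means that the \<open>v\<^sub>i\<close> are independent over the endomorphism ring of \<open>R / I\<close>.\<close>

definition separating :: "nat \<Rightarrow> (nat \<Rightarrow> 'a poly) \<Rightarrow> bool" where
  "separating n v \<longleftrightarrow>
     (\<forall>i<n. \<forall>w. \<exists>a. a \<star> v i \<doteq> w \<and> (\<forall>k<n. k \<noteq> i \<longrightarrow> a \<star> v k \<in> I))"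

text \<open>Independence in \<open>R / I\<close> over the image of the center modulo
  \<open>Ann\<close>: coefficients in \<open>Ann\<close> act as zero and count as trivial.\<close>

definition center_independent :: "nat \<Rightarrow> (nat \<Rightarrow> 'a poly) \<Rightarrow> bool" where
  "center_independent m w \<longleftrightarrow>
     (\<forall>c. (\<forall>j. c j \<in> center) \<and> (\<Sum>j<m. c j \<star> w j) \<in> I \<longrightarrow> (\<forall>j<m. c j \<in> Ann))"

lemma separatingE:
  assumes "separating n v" "i < n"
  obtains a where "a \<star> v i \<doteq> w" "\<And>k. k < n \<Longrightarrow> k \<noteq> i \<Longrightarrow> a \<star> v k \<in> I"
  using assms unfolding separating_def by blast

text \<open>Central coefficients pass through \<open>a\<close>, which kills every term but the one
  at \<open>i\<close>.\<close>

lemma separated_sum: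
  fixes i n :: nat
  assumes "\<And>k. k < n \<Longrightarrow> k \<noteq> i \<Longrightarrow> a \<star> v k \<in> I" "i < n" "\<And>k. c k \<in> center"
  shows "a \<star> (\<Sum>k<n. c k \<star> v k) \<doteq> c i \<star> (a \<star> v i)"
proof -
  have "a \<star> (\<Sum>k<n. c k \<star> v k) = (\<Sum>k<n. c k \<star> (a \<star> v k))"
    by (simp add: mult_sum_right center_left_commute[OF assms(3)])
  also have "\<dots> = c i \<star> (a \<star> v i) + (\<Sum>k\<in>{..<n} - {i}. c k \<star> (a \<star> v k))"
    by (rule sum.remove) (use assms(2) in simp_all)
  moreover have "(\<Sum>k\<in>{..<n} - {i}. c k \<star> (a \<star> v k)) \<in> I"
    by (rule sum_mem, rule mult_mem) (use assms(1) in simp)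
  ultimately show ?thesis by (simp add: left_cong_def)
qed

text \<open>A separator sending \<open>v j\<close> to 1 and the other \<open>v k\<close> to 0 modulo
  \<open>I\<close> reduces a relation to \<open>c j\<close> alone, and \<open>center_in_Ann\<close>
  applies.\<close>

lemma separating_imp_independent:
  assumes "separating n v"
  shows "center_independent n v"
  unfolding center_independent_def
proof (intro allI impI, elim conjE)
  fix c j
  assume c: "\<forall>j. c j \<in> center" "(\<Sum>j<n. c j \<star> v j) \<in> I" and j: "j < n"
  obtain a where a: "a \<star> v j \<doteq> [:1:]" "\<And>k. k < n \<Longrightarrow> k \<noteq> j \<Longrightarrow> a \<star> v k \<in> I"
    using separatingE[OF assms j, of "[:1:]"] by blast
  have "c j \<star> [:1:] \<doteq> c j \<star> (a \<star> v j)"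
    by (rule cong_mult[OF cong_sym[OF a(1)]])
  also have "\<dots> \<doteq> a \<star> (\<Sum>k<n. c k \<star> v k)"
    by (rule cong_sym, rule separated_sum[OF a(2) j]) (use c(1) in simp_all)
  finally have "c j \<star> [:1:] \<in> I" by (rule cong_mem) (rule mult_mem[OF c(2)])
  with c(1) show "c j \<in> Ann" using center_in_Ann[OF _ _ one_notin] by simp
qed

text \<open>Left multiples of \<open>a\<close> take any prescribed value at \<open>p\<close> and
  still vanish at all old \<open>v i\<close>.\<close>

lemma separating_extend:
  assumes sep: "separating n v" and a: "\<And>i. i < n \<Longrightarrow> a \<star> v i \<in> I" "a \<star> p \<notin> I"
  shows "separating (Suc n) (v(n := p))"
  unfolding separating_def
proof (intro allI impI)
  fix i w
  assume i: "i < Suc n"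
  show "\<exists>b. b \<star> (v(n := p)) i \<doteq> w \<and> (\<forall>k<Suc n. k \<noteq> i \<longrightarrow> b \<star> (v(n := p)) k \<in> I)"
  proof (cases "i = n")
    case True
    obtain u where "u \<star> (a \<star> p) \<doteq> w" using generates[OF a(2)] by blast
    with True a(1) show ?thesis
      by (intro exI[of _ "u \<star> a"]) (auto simp: mult_assoc less_Suc_eq mult_mem)
  next
    case False
    with i have "i < n" by simp
    obtain b where b: "b \<star> v i \<doteq> w" "\<And>k. k < n \<Longrightarrow> k \<noteq> i \<Longrightarrow> b \<star> v k \<in> I"
      using separatingE[OF sep \<open>i < n\<close>, of w] by blast
    \<comment> \<open>Modulo \<open>I\<close>, \<open>u \<star> a\<close> agrees with
      \<open>b\<close> at \<open>p\<close> and vanishes at the old elements, so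
      \<open>b - u \<star> a\<close> separates for the longer family.\<close>
    obtain u where u: "u \<star> (a \<star> p) \<doteq> b \<star> p" using generates[OF a(2)] by blast
    have kill: "(b - u \<star> a) \<star> v k \<doteq> b \<star> v k" if "k < n" for k
      using minus_mem[OF mult_mem[OF a(1)[OF that]]]
      by (simp add: left_cong_def mult_diff_left mult_assoc)
    have "(b - u \<star> a) \<star> p \<in> I"
      using cong_sym[OF u] by (simp add: left_cong_def mult_diff_left mult_assoc)
    moreover have "(b - u \<star> a) \<star> v i \<doteq> w"
      using kill[OF \<open>i < n\<close>] b(1) by (rule cong_trans)
    moreover have "(b - u \<star> a) \<star> v k \<in> I" if "k < n" "k \<noteq> i" for k
      using kill[OF that(1)] b(2)[OF that] by (rule cong_mem)
    ultimately show ?thesis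
      using False by (intro exI[of _ "b - u \<star> a"]) (auto simp: less_Suc_eq)
  qed
qed

section \<open>The quotient module and its endomorphism ring\<close>

lemma coset_eq: "I +>\<^bsub>ore_ring \<sigma> \<delta>\<^esub> x = (\<lambda>i. i + x) ` I"
  by (auto simp: a_r_coset_def' add_ore_ring)

abbreviation coset :: "'a poly \<Rightarrow> 'a poly set" where
  "coset x \<equiv> I +>\<^bsub>ore_ring \<sigma> \<delta>\<^esub> x"

lemma coset_eq_iff: "coset x = coset y \<longleftrightarrow> x \<doteq> y"
proof
  assume "coset x = coset y"
  moreover have "x \<in> coset x" by (auto simp: coset_eq image_iff intro!: bexI[of _ 0])
  ultimately obtain i where "i \<in> I" "x = i + y" by (auto simp: coset_eq)
  then show "x \<doteq> y" by (simp add: left_cong_def)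
next
  have "coset x \<subseteq> coset y" if "x \<doteq> y" for x y
  proof
    fix p assume "p \<in> coset x"
    then obtain i where "i \<in> I" "p = i + x" by (auto simp: coset_eq)
    then show "p \<in> coset y"
      using add_mem[of i "x - y"] that
      by (auto simp: coset_eq left_cong_def image_iff intro!: bexI[of _ "i + (x - y)"])
  qed
  moreover assume "x \<doteq> y"
  ultimately show "coset x = coset y" using cong_sym by blast
qed

lemma coset_add: "set_add (ore_ring \<sigma> \<delta>) (coset x) (coset y) = coset (x + y)"
proof (intro equalityI subsetI)
  fix p assume "p \<in> set_add (ore_ring \<sigma> \<delta>) (coset x) (coset y)"
  then obtain i j where ij: "i \<in> I" "j \<in> I" "p = (i + x) + (j + y)"
    unfolding set_add_def' add_ore_ring coset_eq by (elim UN_E imageE) simp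
  from ij(3) have "p = (i + j) + (x + y)" by (simp add: algebra_simps)
  then show "p \<in> coset (x + y)"
    unfolding coset_eq using add_mem[OF ij(1,2)] by (rule image_eqI)
next
  fix p assume "p \<in> coset (x + y)"
  then obtain i where "i \<in> I" "p = (i + x) + (0 + y)"
    unfolding coset_eq by (elim imageE) (simp add: add.assoc)
  then show "p \<in> set_add (ore_ring \<sigma> \<delta>) (coset x) (coset y)"
    unfolding set_add_def' add_ore_ring coset_eq
    by (intro UN_I[of "i + x"] UN_I[of "0 + y"]) simp_all
qed

abbreviation quotient :: "('a poly, 'a poly set) module" where
  "quotient \<equiv> left_quotient (ore_ring \<sigma> \<delta>) I"

lemma carrier_quotient: "carrier quotient = range coset"
  by (auto simp: left_quotient_def A_RCOSETS_def')

lemma quotient_add: "coset x \<oplus>\<^bsub>quotient\<^esub> coset y = coset (x + y)"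
  by (simp add: left_quotient_def coset_add)

lemma quotient_zero: "\<zero>\<^bsub>quotient\<^esub> = coset 0"
  by (simp add: left_quotient_def coset_eq)

lemma quotient_smult: "a \<odot>\<^bsub>quotient\<^esub> coset x = coset (a \<star> x)"
proof -
  \<comment> \<open>The action is a union over representatives; all its members are the same
    coset.\<close>
  have "coset (a \<star> y) = coset (a \<star> x)" if "y \<in> coset x" for y
  proof -
    obtain i where "i \<in> I" "y = i + x" using \<open>y \<in> coset x\<close> by (auto simp: coset_eq)
    then have "y \<doteq> x" by (simp add: left_cong_def)
    then show ?thesis unfolding coset_eq_iff by (rule cong_mult)
  qed
  moreover have "coset x \<noteq> {}" using zero_mem unfolding coset_eq by blast
  ultimately have "(\<Union>y\<in>coset x. coset (a \<star> y)) = coset (a \<star> x)" by blast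
  then show ?thesis by (simp add: left_quotient_def mult_ore_ring)
qed

lemma abelian_group_quotient: "abelian_group quotient"
proof (rule abelian_groupI)
  fix A assume "A \<in> carrier quotient"
  then obtain x where x: "A = coset x" by (auto simp: carrier_quotient)
  show "\<exists>B\<in>carrier quotient. B \<oplus>\<^bsub>quotient\<^esub> A = \<zero>\<^bsub>quotient\<^esub>"
    by (rule bexI[of _ "coset (- x)"])
      (simp_all add: x carrier_quotient quotient_add quotient_zero)
qed (auto simp: carrier_quotient quotient_add quotient_zero ac_simps)

lemma ring_End_quotient: "ring (left_End (ore_ring \<sigma> \<delta>) quotient)"
  by (rule ring_left_End[OF abelian_group_quotient])
    (auto simp: carrier_quotient quotient_add quotient_smult mult_add_right)

end

section \<open>Counting central relations against the rank\<close>

locale ore_finite_rank_simple = ore_maximal_left_ideal +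
  fixes r :: nat and z :: "'a poly"
  assumes free: "free_of_rank_over (ore_ring \<sigma> \<delta>) (ring_center (ore_ring \<sigma> \<delta>)) r"
    and z_center: "z \<in> center" and degree_z: "0 < degree z"
    and Ann_eq: "Ann = left_multiples z"
begin

text \<open>Elements \<open>a i j\<close> that send \<open>v i\<close> to \<open>w j\<close> and
  kill the other \<open>v k\<close> play the role of matrix units. More than \<open>r\<close> of
  them would satisfy a central relation; evaluating it at each \<open>v i\<close> contradicts the
  independence of the \<open>w j\<close>.\<close>

lemma separating_times_independent_le:
  assumes sep: "separating n v" and ind: "center_independent m w"
  shows "n * m \<le> r"
proof (rule ccontr)
  assume "\<not> n * m \<le> r"
  then have card: "r < card ({..<n} \<times> {..<m})" by simp
  have "\<forall>i j. \<exists>a. i < n \<longrightarrow> a \<star> v i \<doteq> w j \<and> (\<forall>k<n. k \<noteq> i \<longrightarrow> a \<star> v k \<in> I)"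
    using sep unfolding separating_def by blast
  then obtain a where a: "\<And>i j. i < n \<Longrightarrow> a i j \<star> v i \<doteq> w j"
    "\<And>i j k. i < n \<Longrightarrow> k < n \<Longrightarrow> k \<noteq> i \<Longrightarrow> a i j \<star> v k \<in> I"
    by metis
  \<comment> \<open>Some coefficient must lie outside \<open>R z = Ann\<close>, as a merely nonzero
    one could still act as zero on \<open>R / I\<close>.\<close>
  obtain c where c: "\<forall>q. c q \<in> center" "\<exists>q\<in>{..<n} \<times> {..<m}. c q \<notin> Ann"
    "(\<Sum>q\<in>{..<n} \<times> {..<m}. c q \<star> a (fst q) (snd q)) = 0"
    using rank_dependence_mod[OF free _ card z_center degree_z, of "\<lambda>q. a (fst q) (snd q)"]
    unfolding Ann_eq by auto
  have "c (i, j) \<in> Ann" if "i < n" "j < m" for i j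
  proof -
    have "(\<Sum>j<m. c (k, j) \<star> (a k j \<star> v i)) \<in> I" if "k \<in> {..<n} - {i}" for k
      by (rule sum_mem, rule mult_mem, rule a(2)) (use that \<open>i < n\<close> in simp_all)
    then have rest: "(\<Sum>k\<in>{..<n} - {i}. \<Sum>j<m. c (k, j) \<star> (a k j \<star> v i)) \<in> I"
      by (rule sum_mem)
    \<comment> \<open>Evaluation at \<open>v i\<close> leaves, up to \<open>I\<close>, only the
      block with first index \<open>i\<close>.\<close>
    have "0 = (\<Sum>q\<in>{..<n} \<times> {..<m}. c q \<star> a (fst q) (snd q)) \<star> v i"
      by (simp only: c(3) mult_0_left)
    also have "\<dots> = (\<Sum>k<n. \<Sum>j<m. c (k, j) \<star> (a k j \<star> v i))"
      by (simp add: mult_sum_left mult_assoc sum.cartesian_product split_def)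
    also have "\<dots> = (\<Sum>j<m. c (i, j) \<star> (a i j \<star> v i))
        + (\<Sum>k\<in>{..<n} - {i}. \<Sum>j<m. c (k, j) \<star> (a k j \<star> v i))"
      by (rule sum.remove) (use \<open>i < n\<close> in simp_all)
    finally have "(\<Sum>j<m. c (i, j) \<star> (a i j \<star> v i))
        = - (\<Sum>k\<in>{..<n} - {i}. \<Sum>j<m. c (k, j) \<star> (a k j \<star> v i))"
      by (simp add: eq_neg_iff_add_eq_0)
    then have main: "(\<Sum>j<m. c (i, j) \<star> (a i j \<star> v i)) \<in> I"
      using minus_mem[OF rest] by simp
    have "(\<Sum>j<m. c (i, j) \<star> w j - c (i, j) \<star> (a i j \<star> v i)) \<in> I"
      using cong_mult[OF cong_sym[OF a(1)[OF \<open>i < n\<close>]]] by (intro sum_mem) (simp only: left_cong_def)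
    then have "(\<Sum>j<m. c (i, j) \<star> w j) \<in> I"
      using add_mem[OF _ main, of "(\<Sum>j<m. c (i, j) \<star> w j) - (\<Sum>j<m. c (i, j) \<star> (a i j \<star> v i))"]
      by (simp add: sum_subtractf)
    moreover have "\<forall>j. c (i, j) \<in> center" using c(1) by simp
    ultimately show ?thesis
      using ind \<open>j < m\<close> unfolding center_independent_def by (elim allE[of _ "\<lambda>j. c (i, j)"]) simp
  qed
  with c(2) show False by auto
qed

lemma separating_square_le: "separating n v \<Longrightarrow> n * n \<le> r"
  by (rule separating_times_independent_le) (auto intro: separating_imp_independent)

text \<open>A separating family of greatest length will do; lengths are bounded since
  \<open>n * n \<le> r\<close>. An element outside \<open>Ann\<close> killing all \<open>v i\<close>
  would move some \<open>p\<close> out of \<open>I\<close> and allow an extension.\<close>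

lemma faithful_separating_exists:
  "\<exists>n v. separating n v \<and> (\<forall>a. (\<forall>i<n. a \<star> v i \<in> I) \<longrightarrow> a \<in> Ann)"
proof -
  define P where "P n \<longleftrightarrow> (\<exists>v. separating n v)" for n
  have bound: "n \<le> r" if "P n" for n
    using that separating_square_le le_square order_trans unfolding P_def by blast
  have "P 0" by (simp add: P_def separating_def)
  define n where "n = Greatest P"
  have "P n" unfolding n_def using \<open>P 0\<close> bound by (rule GreatestI_nat)
  then obtain v where v: "separating n v" by (auto simp: P_def)
  have "a \<in> Ann" if a: "\<forall>i<n. a \<star> v i \<in> I" for a
  proof (rule ccontr)
    assume "a \<notin> Ann"
    then obtain p where "a \<star> p \<notin> I" by (auto simp: Ann_def)
    with v a have "P (Suc n)" unfolding P_def using separating_extend by blast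
    then have "Suc n \<le> n" unfolding n_def using bound by (rule Greatest_le_nat)
    then show False by simp
  qed
  with v show ?thesis by blast
qed

text \<open>Appending \<open>w\<close> to \<open>v\<close> cannot give independent elements, because
  \<open>r < n * Suc n\<close>.\<close>

lemma central_multiple_in_span:
  assumes sep: "separating n v" and n: "0 < n" "r \<le> n * n"
  shows "\<exists>c d. c \<in> center \<and> c \<notin> Ann \<and> (\<forall>i. d i \<in> center) \<and> c \<star> w \<doteq> (\<Sum>i<n. d i \<star> v i)"
proof -
  have "\<not> center_independent (Suc n) (v(n := w))"
  proof
    assume "center_independent (Suc n) (v(n := w))"
    with sep have "n * Suc n \<le> r" by (rule separating_times_independent_le)
    with n show False by simp
  qed
  then obtain c j where c: "\<forall>j. c j \<in> center" "(\<Sum>j<Suc n. c j \<star> (v(n := w)) j) \<in> I"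
    and j: "j < Suc n" "c j \<notin> Ann"
    unfolding center_independent_def by blast
  from c(2) have sum: "(\<Sum>j<n. c j \<star> v j) + c n \<star> w \<in> I" by simp
  \<comment> \<open>Otherwise the relation would involve only the \<open>v j\<close>, whose
    independence puts all coefficients into \<open>Ann\<close>.\<close>
  have "c n \<notin> Ann"
  proof
    assume "c n \<in> Ann"
    then have "c n \<star> w \<in> I" by (simp add: Ann_def)
    then have "(\<Sum>j<n. c j \<star> v j) \<in> I"
      using add_mem[OF sum minus_mem[OF \<open>c n \<star> w \<in> I\<close>]] by simp
    with separating_imp_independent[OF sep] c(1) have "\<forall>j<n. c j \<in> Ann"
      unfolding center_independent_def by blast
    with j \<open>c n \<in> Ann\<close> show False by (metis less_SucE)
  qed
  moreover have "c n \<star> w \<doteq> (\<Sum>i<n. (- c i) \<star> v i)"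
    using sum by (simp add: left_cong_def mult_minus_left sum_negf add.commute)
  ultimately show ?thesis
    using c(1) by (intro exI[of _ "c n"] exI[of _ "\<lambda>i. - c i"]) (simp add: center_minus)
qed

section \<open>Endomorphisms as fractions of central elements\<close>

definition endo_lift :: "('a poly \<Rightarrow> 'a poly) \<Rightarrow> bool" where
  "endo_lift \<phi> \<longleftrightarrow> (\<forall>p q. p \<doteq> q \<longrightarrow> \<phi> p \<doteq> \<phi> q) \<and> (\<forall>a p. \<phi> (a \<star> p) \<doteq> a \<star> \<phi> p)"

text \<open>A central multiple of \<open>\<phi> (v 0)\<close> lies in the central span of the
  \<open>v i\<close>. A separator for \<open>v 0\<close> passes through \<phi> and the central
  factors and cuts the span down to \<open>v 0\<close>, which generates
  \<open>R / I\<close>.\<close>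

lemma endo_lift_central:
  assumes sep: "separating n v" and n: "0 < n" "r \<le> n * n" and \<phi>: "endo_lift \<phi>"
  shows "\<exists>c d. c \<in> center \<and> c \<notin> Ann \<and> d \<in> center \<and> (\<forall>x. c \<star> \<phi> x \<doteq> d \<star> x)"
proof -
  have wd: "\<phi> p \<doteq> \<phi> q" if "p \<doteq> q" for p q using \<phi> that by (simp add: endo_lift_def)
  have lin: "\<phi> (a \<star> p) \<doteq> a \<star> \<phi> p" for a p using \<phi> by (simp add: endo_lift_def)
  obtain c d where c: "c \<in> center" "c \<notin> Ann" "\<And>i. d i \<in> center"
    "c \<star> \<phi> (v 0) \<doteq> (\<Sum>i<n. d i \<star> v i)"
    using central_multiple_in_span[OF sep n] by blast
  \<comment> \<open>Fixing \<open>v 0\<close> is what yields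
    \<open>\<phi> (v 0) \<doteq> a \<star> \<phi> (v 0)\<close>.\<close>
  obtain a where a: "a \<star> v 0 \<doteq> v 0" "\<And>k. k < n \<Longrightarrow> k \<noteq> 0 \<Longrightarrow> a \<star> v k \<in> I"
    using separatingE[OF sep n(1), of "v 0"] by blast
  have v0: "v 0 \<notin> I"
  proof
    assume "v 0 \<in> I"
    obtain b where "b \<star> v 0 \<doteq> [:1:]" using separatingE[OF sep n(1), of "[:1:]"] by blast
    from cong_mem[OF cong_sym[OF this] mult_mem[OF \<open>v 0 \<in> I\<close>]] one_notin show False by contradiction
  qed
  have "c \<star> \<phi> (v 0) \<doteq> c \<star> (a \<star> \<phi> (v 0))"
    by (rule cong_mult) (rule cong_trans[OF wd[OF cong_sym[OF a(1)]] lin])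
  also have "c \<star> (a \<star> \<phi> (v 0)) = a \<star> (c \<star> \<phi> (v 0))"
    by (simp add: center_left_commute[OF c(1)])
  also have "\<dots> \<doteq> a \<star> (\<Sum>i<n. d i \<star> v i)" by (rule cong_mult[OF c(4)])
  also have "\<dots> \<doteq> d 0 \<star> (a \<star> v 0)" by (rule separated_sum[OF a(2) n(1) c(3)])
  also have "\<dots> \<doteq> d 0 \<star> v 0" by (rule cong_mult[OF a(1)])
  finally have at_v0: "c \<star> \<phi> (v 0) \<doteq> d 0 \<star> v 0" .
  have "c \<star> \<phi> x \<doteq> d 0 \<star> x" for x
  proof -
    obtain u where u: "u \<star> v 0 \<doteq> x" using generates[OF v0] by blast
    have "c \<star> \<phi> x \<doteq> c \<star> (u \<star> \<phi> (v 0))"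
      by (rule cong_mult) (rule cong_trans[OF wd[OF cong_sym[OF u]] lin])
    also have "\<dots> = u \<star> (c \<star> \<phi> (v 0))" by (simp add: center_left_commute[OF c(1)])
    also have "\<dots> \<doteq> u \<star> (d 0 \<star> v 0)" by (rule cong_mult[OF at_v0])
    also have "\<dots> = d 0 \<star> (u \<star> v 0)" by (rule center_left_commute[OF c(3)])
    also have "\<dots> \<doteq> d 0 \<star> x" by (rule cong_mult[OF u])
    finally show ?thesis .
  qed
  with c show ?thesis by blast
qed

text \<open>Both \<open>c \<star> \<phi>\<close> and \<open>c' \<star> \<psi>\<close> act as central
  elements, so \<open>c' \<star> c\<close> kills the commutator; its factors lie outside
  \<open>Ann\<close> and cancel.\<close>

lemma endo_lifts_commute:
  assumes sep: "separating n v" and n: "0 < n" "r \<le> n * n"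
    and \<phi>: "endo_lift \<phi>" and \<psi>: "endo_lift \<psi>"
  shows "\<phi> (\<psi> x) \<doteq> \<psi> (\<phi> x)"
proof -
  obtain c d where c: "c \<in> center" "c \<notin> Ann" "d \<in> center" "\<And>x. c \<star> \<phi> x \<doteq> d \<star> x"
    using endo_lift_central[OF sep n \<phi>] by blast
  obtain c' d' where c': "c' \<in> center" "c' \<notin> Ann" "d' \<in> center" "\<And>x. c' \<star> \<psi> x \<doteq> d' \<star> x"
    using endo_lift_central[OF sep n \<psi>] by blast
  have "c' \<star> (c \<star> \<phi> (\<psi> x)) \<doteq> c' \<star> (d \<star> \<psi> x)" by (rule cong_mult[OF c(4)])
  also have "\<dots> = d \<star> (c' \<star> \<psi> x)" by (simp add: center_left_commute[OF c(3)])
  also have "\<dots> \<doteq> d \<star> (d' \<star> x)" by (rule cong_mult[OF c'(4)])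
  also have "\<dots> = d' \<star> (d \<star> x)" by (rule center_left_commute[OF c'(3)])
  also have "\<dots> \<doteq> d' \<star> (c \<star> \<phi> x)" by (rule cong_mult[OF cong_sym[OF c(4)]])
  also have "\<dots> = c \<star> (d' \<star> \<phi> x)" by (rule center_left_commute[OF c(1)])
  also have "\<dots> \<doteq> c \<star> (c' \<star> \<psi> (\<phi> x))" by (rule cong_mult[OF cong_sym[OF c'(4)]])
  also have "\<dots> = c' \<star> (c \<star> \<psi> (\<phi> x))" by (rule center_left_commute[OF c'(1)])
  finally have "c' \<star> (c \<star> (\<phi> (\<psi> x) - \<psi> (\<phi> x))) \<in> I"
    by (simp add: left_cong_def mult_diff_right)
  then have "c \<star> (\<phi> (\<psi> x) - \<psi> (\<phi> x)) \<in> I"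
    using center_in_Ann[OF c'(1)] c'(2) by blast
  then show ?thesis
    unfolding left_cong_def using center_in_Ann[OF c(1)] c(2) by blast
qed

text \<open>Choosing a representative of each image makes the congruence calculus available for
  endomorphisms.\<close>

lemma endomorphism_lift:
  assumes \<phi>: "\<phi> \<in> carrier (left_End (ore_ring \<sigma> \<delta>) quotient)"
  shows "\<exists>\<phi>'. endo_lift \<phi>' \<and> (\<forall>x. \<phi> (coset x) = coset (\<phi>' x))"
proof -
  have \<phi>_maps: "\<phi> \<in> carrier quotient \<rightarrow>\<^sub>E carrier quotient"
    using \<phi> by (simp add: left_End_def)
  have "\<forall>x. \<exists>y. \<phi> (coset x) = coset y"
  proof
    fix x
    have "\<phi> (coset x) \<in> carrier quotient"
      using \<phi>_maps by (rule PiE_mem) (simp add: carrier_quotient)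
    then show "\<exists>y. \<phi> (coset x) = coset y" unfolding carrier_quotient by blast
  qed
  from choice[OF this] obtain \<phi>' where \<phi>': "\<And>x. \<phi> (coset x) = coset (\<phi>' x)" by blast
  have "\<phi>' p \<doteq> \<phi>' q" if "p \<doteq> q" for p q
    using that unfolding coset_eq_iff[symmetric] \<phi>'[symmetric] by simp
  moreover have "\<phi>' (a \<star> p) \<doteq> a \<star> \<phi>' p" for a p
  proof -
    have "\<phi> (a \<odot>\<^bsub>quotient\<^esub> coset p) = a \<odot>\<^bsub>quotient\<^esub> \<phi> (coset p)"
      using \<phi> by (simp add: left_End_def carrier_quotient)
    then show ?thesis by (simp add: quotient_smult \<phi>' coset_eq_iff)
  qed
  ultimately show ?thesis using \<phi>' unfolding endo_lift_def by blast
qed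

lemma cring_End_quotient:
  assumes sep: "separating n v" and n: "0 < n" "r \<le> n * n"
  shows "cring (left_End (ore_ring \<sigma> \<delta>) quotient)" (is "cring ?E")
proof -
  interpret E: ring ?E by (rule ring_End_quotient)
  have "\<phi> \<otimes>\<^bsub>?E\<^esub> \<psi> = \<psi> \<otimes>\<^bsub>?E\<^esub> \<phi>" if \<phi>: "\<phi> \<in> carrier ?E" and \<psi>: "\<psi> \<in> carrier ?E" for \<phi> \<psi>
  proof -
    obtain \<phi>' \<psi>' where lift: "endo_lift \<phi>'" "\<And>x. \<phi> (coset x) = coset (\<phi>' x)"
      "endo_lift \<psi>'" "\<And>x. \<psi> (coset x) = coset (\<psi>' x)"
      using endomorphism_lift[OF \<phi>] endomorphism_lift[OF \<psi>] by blast
    have "\<phi> (\<psi> A) = \<psi> (\<phi> A)" if A: "A \<in> carrier quotient" for A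
    proof -
      obtain x where "A = coset x" using A by (auto simp: carrier_quotient)
      then show ?thesis
        using endo_lifts_commute[OF sep n lift(1,3), of x] by (simp add: lift(2,4) coset_eq_iff)
    qed
    then show ?thesis
      unfolding left_End_def compose_def by (simp cong: restrict_cong)
  qed
  then show ?thesis
    by (intro cring.intro E.ring_axioms E.monoid_comm_monoidI)
qed

end

section \<open>Right divisors of least degree\<close>

context ore_data
begin

text \<open>Take a nonzero element of least degree in \<open>R p + R g\<close>: remainders on
  division by it stay in that left ideal and hence vanish.\<close>

lemma greatest_common_right_divisor:
  assumes "g \<noteq> 0"
  shows "\<exists>h a b. h \<noteq> 0 \<and> h = a \<star> p + b \<star> g \<and> p \<in> left_multiples h \<and> g \<in> left_multiples h"
proof -
  define S where "S = {h. h \<noteq> 0 \<and> (\<exists>a b. h = a \<star> p + b \<star> g)}"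
  have "g = 0 \<star> p + [:1:] \<star> g" by (simp add: mult_one_left)
  then have "g \<in> S" unfolding S_def using assms by blast
  from ex_has_least_nat[of "\<lambda>h. h \<in> S", OF this, of degree]
  obtain h where h: "h \<in> S" "\<And>s. s \<in> S \<Longrightarrow> degree h \<le> degree s" by blast
  from h(1) obtain a b where ab: "h \<noteq> 0" "h = a \<star> p + b \<star> g" by (auto simp: S_def)
  have "x \<in> left_multiples h" if x: "x = a' \<star> p + b' \<star> g" for x a' b'
  proof -
    obtain q where q: "x - q \<star> h = 0 \<or> degree (x - q \<star> h) < degree h"
      using right_division[OF ab(1)] by blast
    have "x - q \<star> h = (a' - q \<star> a) \<star> p + (b' - q \<star> b) \<star> g"
      unfolding x ab(2) by (simp add: mult_add_right mult_diff_left mult_assoc)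
    then have "x - q \<star> h = 0 \<or> x - q \<star> h \<in> S" unfolding S_def by blast
    with q h(2) have "x - q \<star> h = 0" by (metis leD)
    then show ?thesis by simp
  qed
  from this[of p "[:1:]" 0] this[of g 0 "[:1:]"] ab show ?thesis
    by (simp add: mult_one_left) blast
qed

lemma left_multiples_subset: "x \<in> left_multiples h \<Longrightarrow> left_multiples x \<subseteq> left_multiples h"
  by (auto simp flip: mult_assoc)

text \<open>The greatest common right divisor of \<open>p\<close> and \<open>g\<close> divides
  \<open>f\<close> on the right. By minimality it is constant or has the degree of \<open>g\<close>,
  and the latter would put \<open>p\<close> into \<open>R g\<close>.\<close>

lemma minimal_right_divisor_maximal:
  assumes g: "0 < degree g" "f \<in> left_multiples g"
    and least: "\<And>h. 0 < degree h \<Longrightarrow> f \<in> left_multiples h \<Longrightarrow> degree g \<le> degree h"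
  shows "ore_maximal_left_ideal \<sigma> \<delta> (left_multiples g)"
proof unfold_locales
  have g0: "g \<noteq> 0" using g(1) by auto
  show "x + y \<in> left_multiples g" if "x \<in> left_multiples g" "y \<in> left_multiples g" for x y
    using that by (auto simp flip: mult_add_left)
  show "a \<star> x \<in> left_multiples g" if "x \<in> left_multiples g" for a x
    using that by (auto simp flip: mult_assoc)
  show "[:1:] \<notin> left_multiples g"
  proof
    assume "[:1:] \<in> left_multiples g"
    then obtain q where q: "[:1:] = q \<star> g" by blast
    then have "q \<noteq> 0" by auto
    from degree_mult[OF this g0] have "degree [:1 :: 'a:] = degree q + degree g"
      unfolding q .
    with g(1) show False by simp
  qed
  show "\<exists>u. u \<star> p - [:1:] \<in> left_multiples g" if p: "p \<notin> left_multiples g" for p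
  proof -
    obtain h a b where h: "h \<noteq> 0" "h = a \<star> p + b \<star> g" "p \<in> left_multiples h" "g \<in> left_multiples h"
      using greatest_common_right_divisor[OF g0] by blast
    have "degree h = 0"
    proof (rule ccontr)
      assume "degree h \<noteq> 0"
      then have le: "degree g \<le> degree h"
        using least left_multiples_subset[OF h(4)] g(2) by blast
      \<comment> \<open>Equal degrees make the cofactor \<open>q\<close> constant, so
        \<open>g\<close> and \<open>h\<close> generate the same left ideal.\<close>
      obtain q where q: "g = q \<star> h" using h(4) by blast
      have "q \<noteq> 0" using q g0 by auto
      moreover from this have "degree q = 0" using le degree_mult[OF _ h(1), of q] q by simp
      ultimately obtain v where "v \<star> q = [:1:]" using degree_0_invertible by blast
      then have "h = v \<star> g" unfolding q by (simp flip: mult_assoc add: mult_one_left)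
      then have "h \<in> left_multiples g" by blast
      with h(3) p left_multiples_subset show False by blast
    qed
    with h(1) obtain v where v: "v \<star> h = [:1:]" using degree_0_invertible by blast
    \<comment> \<open>The Bezout identity for \<open>h\<close>, multiplied by the inverse of the
      constant \<open>h\<close>.\<close>
    have "(v \<star> a) \<star> p - [:1:] = (- (v \<star> b)) \<star> g"
      unfolding v[symmetric] h(2) by (simp add: mult_add_right mult_assoc mult_minus_left)
    then show ?thesis by blast
  qed
qed

section \<open>Units and irreducibility\<close>

lemma degree_0_unit:
  assumes "u \<noteq> 0" "degree u = 0"
  shows "u \<in> Units (ore_ring \<sigma> \<delta>)"
  using degree_0_invertible[OF assms] by (auto simp: Units_def mult_ore_ring one_ore_ring)

lemma unit_degree_0:
  assumes "u \<in> Units (ore_ring \<sigma> \<delta>)"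
  shows "degree u = 0"
proof -
  obtain v where v: "v \<star> u = [:1:]"
    using assms by (auto simp: Units_def mult_ore_ring one_ore_ring)
  then have "v \<noteq> 0" "u \<noteq> 0" by auto
  from degree_mult[OF this] show ?thesis by (simp add: v)
qed

text \<open>In a factorization \<open>f = g \<star> h\<close> a nonconstant \<open>h\<close> has at
  least the degree of \<open>f\<close>, which leaves \<open>g\<close> a nonzero constant, hence a
  unit.\<close>

lemma irreducible_of_minimal_degree:
  assumes f: "0 < degree f"
    and least: "\<And>h. 0 < degree h \<Longrightarrow> f \<in> left_multiples h \<Longrightarrow> degree f \<le> degree h"
  shows "irreducible_elt (ore_ring \<sigma> \<delta>) f"
proof -
  have "g \<in> Units (ore_ring \<sigma> \<delta>) \<or> h \<in> Units (ore_ring \<sigma> \<delta>)" if fgh: "f = g \<star> h" for g h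
  proof (cases "degree h = 0")
    case True
    moreover have "h \<noteq> 0" using fgh f by auto
    ultimately show ?thesis using degree_0_unit by blast
  next
    case False
    have nz: "g \<noteq> 0" "h \<noteq> 0" using fgh f by auto
    have "degree f \<le> degree h" using least[of h] False fgh by blast
    with degree_mult[OF nz] fgh have "degree g = 0" by simp
    with nz show ?thesis using degree_0_unit by blast
  qed
  moreover have "f \<notin> Units (ore_ring \<sigma> \<delta>)" using f unit_degree_0[of f] by auto
  ultimately show ?thesis
    using f by (auto simp: irreducible_elt_def mult_ore_ring zero_ore_ring)
qed

end

section \<open>The annihilator of the simple quotient\<close>

lemma (in ore_maximal_left_ideal) ideal_Ann: "ideal Ann (ore_ring \<sigma> \<delta>)"
proof (rule idealI[OF ore_ring_is_ring])
  interpret ring "ore_ring \<sigma> \<delta>" by (rule ore_ring_is_ring)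
  have minus: "\<ominus>\<^bsub>ore_ring \<sigma> \<delta>\<^esub> a = - a" for a
    by (rule minus_equality) (simp_all add: add_ore_ring zero_ore_ring)
  show "subgroup Ann (add_monoid (ore_ring \<sigma> \<delta>))"
  proof (rule add.subgroupI)
    show "Ann \<noteq> {}" by (auto simp: Ann_def intro!: exI[of _ 0])
    show "\<ominus>\<^bsub>ore_ring \<sigma> \<delta>\<^esub> a \<in> Ann" if "a \<in> Ann" for a
      using that by (simp add: minus Ann_def mult_minus_left minus_mem)
    show "a \<oplus>\<^bsub>ore_ring \<sigma> \<delta>\<^esub> b \<in> Ann" if "a \<in> Ann" "b \<in> Ann" for a b
      using that by (simp add: add_ore_ring Ann_def mult_add_left add_mem)
  qed simp
  show "x \<otimes>\<^bsub>ore_ring \<sigma> \<delta>\<^esub> a \<in> Ann" if "a \<in> Ann" for a x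
    using that by (simp add: mult_ore_ring Ann_def mult_assoc mult_mem)
  show "a \<otimes>\<^bsub>ore_ring \<sigma> \<delta>\<^esub> x \<in> Ann" if "a \<in> Ann" for a x
    using that by (simp add: mult_ore_ring Ann_def mult_assoc)
qed

text \<open>A central element of \<open>I\<close> acts as zero on \<open>R / I\<close>, so the
  proper twosided ideal \<open>Ann\<close> contains the maximal one.\<close>

lemma (in ore_maximal_left_ideal) Ann_eq_maximal:
  assumes z: "z \<in> center" "z \<in> I" and max: "maximalideal (left_multiples z) (ore_ring \<sigma> \<delta>)"
  shows "Ann = left_multiples z"
proof -
  have "left_multiples z \<subseteq> Ann"
  proof
    fix a assume "a \<in> left_multiples z"
    then obtain q where "a = q \<star> z" by blast
    then have "a \<star> p = (q \<star> p) \<star> z" for p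
      by (simp add: mult_assoc centerD[OF z(1)])
    then show "a \<in> Ann" using mult_mem[OF z(2)] by (simp add: Ann_def)
  qed
  then have "Ann = left_multiples z \<or> Ann = carrier (ore_ring \<sigma> \<delta>)"
    by (intro maximalideal.I_maximal[OF max ideal_Ann]) simp_all
  then show ?thesis using one_notin_Ann by auto
qed

theorem proposition4p1:
  fixes \<sigma> \<delta> :: "'a::division_ring \<Rightarrow> 'a"
    and R :: "'a poly ring"
    and f fstar :: "'a poly"
    and r :: nat
  assumes "ring_automorphism \<sigma>"
    and "sigma_derivation \<sigma> \<delta>"
    and "R = ore_ring \<sigma> \<delta>"
    and "free_of_rank_over R (ring_center R) r"
    and "f \<in> carrier R"
    and "is_bound_of R fstar f"
    and "fstar \<in> ring_center R"
    and "prime_twosided R fstar"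
    and "real (degree fstar) = sqrt (real r) * real (degree f)"
  shows "irreducible_elt R f \<and> cring (left_End R (left_quotient R (PIdl\<^bsub>R\<^esub> f)))"
proof -
  interpret ore_data \<sigma> \<delta> using assms(1,2) by unfold_locales
  have R: "R = ore_ring \<sigma> \<delta>" by (rule assms(3))
  have z: "fstar \<in> center" "0 < degree fstar"
    and max: "maximalideal (left_multiples fstar) (ore_ring \<sigma> \<delta>)"
    using assms(7,8) unfolding R prime_twosided_def ring_center_eq PIdl_eq by simp_all
  have "left_multiples fstar \<subseteq> left_multiples f"
    using assms(6) unfolding R is_bound_of_def PIdl_eq by simp
  moreover have "fstar \<in> left_multiples fstar"
    by (rule range_eqI[of _ _ "[:1:]"]) (simp add: mult_one_left)
  ultimately have fstar_f: "fstar \<in> left_multiples f" ..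
  have deg_f: "0 < degree f" using assms(9) z(2) by (cases "degree f = 0") simp_all
  have "f \<in> left_multiples f"
    by (rule range_eqI[of _ _ "[:1:]"]) (simp add: mult_one_left)
  with deg_f ex_has_least_nat[of "\<lambda>g. 0 < degree g \<and> f \<in> left_multiples g" f degree]
  obtain g where g: "0 < degree g" "f \<in> left_multiples g"
    and least: "\<And>h. 0 < degree h \<Longrightarrow> f \<in> left_multiples h \<Longrightarrow> degree g \<le> degree h"
    by blast
  have g0: "g \<noteq> 0" using g(1) by auto
  interpret ore_maximal_left_ideal \<sigma> \<delta> "left_multiples g"
    using g least by (rule minimal_right_divisor_maximal)
  have "fstar \<in> left_multiples g"
    using fstar_f left_multiples_subset[OF g(2)] by blast
  from Ann_eq_maximal[OF z(1) this max] have Ann: "Ann = left_multiples fstar" .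
  interpret ore_finite_rank_simple \<sigma> \<delta> "left_multiples g" r fstar
    using assms(4) z Ann unfolding R by unfold_locales
  obtain n v where sep: "separating n v"
    and faithful: "\<And>a. (\<And>i. i < n \<Longrightarrow> a \<star> v i \<in> left_multiples g) \<Longrightarrow> a \<in> Ann"
    using faithful_separating_exists by blast
  obtain h where h: "h \<noteq> 0" "degree h \<le> n * degree g" "\<And>i. i < n \<Longrightarrow> h \<star> v i \<in> left_multiples g"
    using common_annihilator[OF g0, of n v] by blast
  \<comment> \<open>As \<open>h\<close> kills every \<open>v i\<close>, faithfulness puts it into
    \<open>R fstar\<close>, and its degree bounds that of \<open>fstar\<close>.\<close>
  obtain q where q: "h = q \<star> fstar" using faithful[OF h(3)] Ann by blast
  with h(1) have "q \<noteq> 0" "fstar \<noteq> 0" by auto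
  from degree_mult[OF this] h(2) have deg_fstar: "degree fstar \<le> n * degree g"
    unfolding q by simp
  have n: "0 < n" using deg_fstar z(2) by (cases n) simp_all
  obtain u where u: "f = u \<star> g" using g(2) by blast
  have u0: "u \<noteq> 0" using u deg_f by auto
  have deg_u: "degree f = degree u + degree g" unfolding u by (rule degree_mult[OF u0 g0])
  have bound: "sqrt (real r) * real (degree f) \<le> real n * real (degree g)"
    using deg_fstar assms(9) by (metis of_nat_le_iff of_nat_mult)
  \<comment> \<open>As \<open>g\<close> divides \<open>f\<close>, its degree may replace that of
    \<open>f\<close> on the left of \<open>bound\<close>; cancelling it leaves
    \<open>sqrt r \<le> n\<close>.\<close>
  have "sqrt (real r) * real (degree g) \<le> sqrt (real r) * real (degree f)"
    using deg_u by (intro mult_left_mono) simp_all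
  from order_trans[OF this bound] have "sqrt (real r) \<le> real n"
    by (rule mult_right_le_imp_le) (use g(1) in simp)
  then have "sqrt (real r) ^ 2 \<le> real n ^ 2" by (intro power_mono) simp_all
  then have r_le: "r \<le> n * n" by (simp add: power2_eq_square flip: of_nat_mult)
  \<comment> \<open>Conversely, counting gives \<open>n \<le> sqrt r\<close>, so \<open>n\<close>
    may replace \<open>sqrt r\<close> on the left of \<open>bound\<close>, and cancelling
    \<open>n\<close> compares the degrees of \<open>f\<close> and \<open>g\<close>.\<close>
  have "real n ^ 2 \<le> real r"
    using separating_square_le[OF sep] by (simp add: power2_eq_square flip: of_nat_mult)
  then have "real n \<le> sqrt (real r)" by (rule real_le_rsqrt)
  then have "real n * real (degree f) \<le> sqrt (real r) * real (degree f)"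
    by (intro mult_right_mono) simp_all
  also note bound
  finally have "degree f \<le> degree g" using n by simp
  \<comment> \<open>Thus \<open>f\<close> and \<open>g\<close> differ by a unit and
    \<open>R f = R g\<close>: the results for \<open>R / R g\<close> hold for
    \<open>R / R f\<close>.\<close>
  with deg_u have "degree u = 0" by simp
  with u0 obtain w where w: "w \<star> u = [:1:]" using degree_0_invertible by blast
  have "g = w \<star> f" unfolding u by (simp add: w mult_one_left flip: mult_assoc)
  then have "g \<in> left_multiples f" by blast
  then have ideal: "PIdl\<^bsub>R\<^esub> f = left_multiples g"
    unfolding R PIdl_eq using left_multiples_subset g(2) by blast
  have "irreducible_elt R f"
    unfolding R using deg_f \<open>degree f \<le> degree g\<close> least order_trans
    by (intro irreducible_of_minimal_degree) blast+
  moreover have "cring (left_End R (left_quotient R (PIdl\<^bsub>R\<^esub> f)))"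
    unfolding ideal unfolding R by (rule cring_End_quotient[OF sep n r_le])
  ultimately show ?thesis by blast
qed

end
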